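(* Let $f:\mathbb{R}^{m\times n}\to\mathbb{R}$ be twice continuously differentiable and let $(X_0,G_0)\in\mathcal{M}_h$ be such that the sublevel set $\{X:f(X)\le f(X_0)\}$ is compact. Then any sequence $\{(X_k,G_k)\}_{k\ge0}\subseteq\mathcal{M}_h$ started at $(X_0,G_0)$ and generated by a monotone algorithm, i.e. satisfying $\bar f(X_{k+1},G_{k+1})\le\bar f(X_k,G_k)$ for all $k$, has at least one accumulation point. Moreover, if the accumulation point $(X^*,G^* )$ is second-order stationary for the problem $\min_{(X,G)\in\mathcal{M}_h}\bar f(X,G)$, then $X^*$ is first-order stationary for the problem of minimizing $f$ over $\mathbb{R}^{m\times n}_{\le r}\cap\mathcal{H}$.
   Context: Let $r\le\min\{m,n\}$ and $\mathbb{R}^{m\times n}_{\le r}=\{X\in\mathbb{R}^{m\times n}:\operatorname{rank}(X)\le r\}$. The map $h:\mathbb{R}^{m\times n}\to\mathbb{R}^q$ is smooth and orthogonally invariant, i.e. $h(XQ)=h(X)$ for all $X$ and all $Q\in\mathcal{O}(n)=\{Q\in\mathbb{R}^{n\times n}:Q^\top Q=I_n\}$. Put $\mathcal{H}=\{X\in\mathbb{R}^{m\times n}:h(X)=0\}$; it is assumed that the differential $\mathrm{D}h_X$ has rank $q$ for all $X\in\mathcal{H}$. $\mathrm{Sym}(n)$ is the space of symmetric $n\times n$ matrices and $\mathrm{Gr}(n,n-r)=\{G\in\mathrm{Sym}(n):G^2=G,\ \operatorname{rank}(G)=n-r\}$. Define $$\mathcal{M}_h=\{(X,G)\in\mathbb{R}^{m\times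 n}\times\mathrm{Gr}(n,n-r):\ XG=0,\ h(X)=0\},$$ an embedded submanifold of $\mathbb{R}^{m\times n}\times\mathrm{Sym}(n)$, and $\phi(X,G)=X$, so that $\phi(\mathcal{M}_h)=\mathbb{R}^{m\times n}_{\le r}\cap\mathcal{H}$. Put $\bar f=f\circ\phi$. A point $X\in\mathbb{R}^{m\times n}_{\le r}\cap\mathcal{H}$ is (first-order) stationary for minimizing $f$ over $\mathbb{R}^{m\times n}_{\le r}\cap\mathcal{H}$ if $\langle\nabla f(X),\eta\rangle\ge0$ for all $\eta$ in the Bouligand tangent cone $\mathrm{T}_X(\mathbb{R}^{m\times n}_{\le r}\cap\mathcal{H})$, where $\mathrm{T}_X\mathcal{X}=\{\lim_k (X_k-X)/t_k:\ X_k\in\mathcal{X},\ t_k>0,\ t_k\to0\}$. A point $(X,G)\in\mathcal{M}_h$ is second-order stationary for minimizing $\bar f$ over $\mathcal{M}_h$ if $\mathrm{D}\bar f_{(X,G)}[\eta,\zeta]=0$ for all $(\eta,\zeta)\in\mathrm{T}_{(X,G)}\mathcal{M}_h$ and $(\bar f\circ\gamma)''(0)\ge0$ for all (smooth) curves $\gamma$ on $\mathcal{M}_h$ with $\gamma(0)=(X,G)$. *)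

theory Defs
  imports "HOL-Analysis.Analysis"
begin

text \<open>For open \<open>S\<close>: \<open>f\<close> is of class \<open>C^k\<close> on \<open>S\<close>, expressed by iterated directional derivatives.\<close>

primrec Ck_on :: "nat \<Rightarrow> ('a::euclidean_space \<Rightarrow> 'b::euclidean_space) \<Rightarrow> 'a set \<Rightarrow> bool" where
  "Ck_on 0 f S \<longleftrightarrow> continuous_on S f"
| "Ck_on (Suc k) f S \<longleftrightarrow>
     (\<forall>x\<in>S. f differentiable (at x)) \<and> (\<forall>v. Ck_on k (\<lambda>x. frechet_derivative f (at x) v) S)"

definition smooth_on :: "('a::euclidean_space \<Rightarrow> 'b::euclidean_space) \<Rightarrow> 'a set \<Rightarrow> bool" where
  "smooth_on f S \<longleftrightarrow> (\<forall>k. Ck_on k f S)"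

definition gradient :: "('a::euclidean_space \<Rightarrow> real) \<Rightarrow> 'a \<Rightarrow> 'a" where
  "gradient f x = (THE D. GDERIV f x :> D)"

definition tangent_cone :: "'a::euclidean_space set \<Rightarrow> 'a \<Rightarrow> 'a set" where
  "tangent_cone S x = {\<eta>. \<exists>(X :: nat \<Rightarrow> 'a) (t :: nat \<Rightarrow> real).
     (\<forall>k. X k \<in> S) \<and> (\<forall>k. t k > 0) \<and> t \<longlonglongrightarrow> 0 \<and>
     (\<lambda>k. (X k - x) /\<^sub>R t k) \<longlonglongrightarrow> \<eta>}"

definition first_order_stationary ::
  "'a::euclidean_space set \<Rightarrow> ('a \<Rightarrow> real) \<Rightarrow> 'a \<Rightarrow> bool" where
  "first_order_stationary S f x \<longleftrightarrow>
     x \<in> S \<and> (\<forall>\<eta>\<in>tangent_cone S x. gradient f x \<bullet> \<eta> \<ge> 0)"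

text \<open>A curve is a total function of which only the restriction to some neighbourhood of \<open>0\<close>
  is relevant.\<close>

definition smooth_curve_at :: "'a::euclidean_space set \<Rightarrow> 'a \<Rightarrow> (real \<Rightarrow> 'a) \<Rightarrow> bool" where
  "smooth_curve_at M p \<gamma> \<longleftrightarrow>
     \<gamma> 0 = p \<and> (\<exists>e>0. smooth_on \<gamma> {-e<..<e} \<and> \<gamma> ` {-e<..<e} \<subseteq> M)"

text \<open>For an embedded submanifold \<open>M\<close> of a Euclidean space, the tangent space consists of the
  velocities of the smooth curves on \<open>M\<close>.\<close>

definition tangent_space :: "'a::euclidean_space set \<Rightarrow> 'a \<Rightarrow> 'a set" where
  "tangent_space M p = {vector_derivative \<gamma> (at 0) |\<gamma>. smooth_curve_at M p \<gamma>}"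

text \<open>The objective \<open>F\<close> is given on the ambient space. Its differential along \<open>M\<close> is the
  restriction of the ambient one to the tangent space.\<close>

definition second_order_stationary ::
  "'a::euclidean_space set \<Rightarrow> ('a \<Rightarrow> real) \<Rightarrow> 'a \<Rightarrow> bool" where
  "second_order_stationary M F p \<longleftrightarrow>
     p \<in> M \<and>
     (\<forall>v\<in>tangent_space M p. frechet_derivative F (at p) v = 0) \<and>
     (\<forall>\<gamma>. smooth_curve_at M p \<gamma> \<longrightarrow> deriv (deriv (F \<circ> \<gamma>)) 0 \<ge> 0)"

definition accumulation_point_in ::
  "'a::topological_space set \<Rightarrow> (nat \<Rightarrow> 'a) \<Rightarrow> 'a \<Rightarrow> bool" where
  "accumulation_point_in M Z p \<longleftrightarrow>
     p \<in> M \<and> (\<exists>\<sigma>::nat \<Rightarrow> nat. strict_mono \<sigma> \<and> (Z \<circ> \<sigma>) \<longlonglongrightarrow> p)"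

definition bounded_rank :: "nat \<Rightarrow> (real^'n^'m) set" where
  "bounded_rank r = {X. rank X \<le> r}"

definition zero_set :: "(real^'n^'m \<Rightarrow> real^'q) \<Rightarrow> (real^'n^'m) set" where
  "zero_set h = {X. h X = 0}"

definition Sym :: "(real^'n^'n) set" where
  "Sym = {G. transpose G = G}"

text \<open>Grassmannian of \<open>k\<close>-dimensional subspaces, represented by orthogonal projectors.\<close>

definition Gr :: "nat \<Rightarrow> (real^'n^'n) set" where
  "Gr k = {G \<in> Sym. G ** G = G \<and> rank G = k}"

definition M_h ::
  "nat \<Rightarrow> (real^'n^'m \<Rightarrow> real^'q) \<Rightarrow> ((real^'n^'m) \<times> (real^'n^'n)) set" where
  "M_h r h = {(X, G). G \<in> Gr (CARD('n) - r) \<and> X ** G = 0 \<and> h X = 0}"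

definition \<phi> :: "(real^'n^'m) \<times> (real^'n^'n) \<Rightarrow> real^'n^'m" where
  "\<phi> = (\<lambda>(X, G). X)"

end

theory Submission
  imports Defs
begin

text \<open>
  Existence of an accumulation point is compactness: monotonicity keeps the sequence in the product of
  the compact sublevel set with the Grassmannian, which is compact, and the lifted set is closed.

  For the second part, fix a second-order stationary point \<open>(X, G)\<close> of the lift. Every such
  point projects to a first-order stationary point, and more precisely the derivative \<open>Df\<close>
  of the objective at \<open>X\<close> vanishes on the whole tangent cone. A tangent direction
  \<open>\<eta>\<close> satisfies \<open>Dh \<eta> = 0\<close>
  (\<open>derivative_vanishes_on_tangent_cone\<close>). Differentiating the orthogonal invariance of
  \<open>h\<close> along the reflection \<open>1 - 2 G\<close>, which fixes \<open>X\<close>, shows that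
  \<open>Dh\<close> does not see \<open>\<eta> G\<close> (\<open>Dh_mult_projector\<close>). So
  \<open>\<eta>\<close> splits into \<open>\<eta> (1 - G)\<close> and \<open>\<eta> G\<close>, and the
  two parts are handled by different curves on the lift, all of the form \<open>t \<mapsto> (x(t) R(t),
  R(t)\<^sup>T G R(t))\<close> with \<open>x\<close> in the slice \<open>x(t) G = 0\<close>,
  \<open>h(x(t)) = 0\<close>, and \<open>R\<close> a rotation in a plane (\<open>rotated_curve\<close>).

  With \<open>R = 1\<close> the curves in the slice give \<open>Df (\<eta> (1 - G)) = 0\<close>. Their
  existence is the implicit function theorem for the restriction of \<open>h\<close> to the linear space
  of matrices killed by \<open>G\<close>, which is a submersion at \<open>X\<close> by the invariance
  argument (\<open>smooth_curve_in_level_set\<close>).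

  For \<open>\<eta> G\<close> there are two cases. If \<open>X\<close> has rank \<open>r\<close>,
  tangency to the matrices of rank at most \<open>r\<close> forces the columns of \<open>\<eta> G\<close>
  into the range of \<open>X\<close> (\<open>tangent_cone_bounded_rank\<close>), and then \<open>\<eta>
  G\<close> is a combination of velocities of \<open>t \<mapsto> X R(t)\<close>
  (\<open>Df_rotation_direction\<close>). If \<open>X\<close> has smaller rank, there is a unit vector
  \<open>w\<close> in the kernel of \<open>X\<close> that is orthogonal to the range of \<open>G\<close>.
  For a unit vector \<open>u\<close> in that range and arbitrary \<open>v\<close>, a slice curve with
  velocity \<open>outer v w\<close> (the rank-one matrix with entries \<open>v_i w_j\<close>), combined
  with the rotation from \<open>w\<close> to \<open>u\<close> at angular speed \<open>K\<close>, has a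
  velocity independent of \<open>K\<close> and an acceleration containing \<open>2 K outer v u\<close>.
  The second-order condition for all \<open>K\<close> of either sign yields \<open>Df (outer v u) =
  0\<close> (\<open>Df_kernel_direction\<close>), hence \<open>Df (\<eta> G) = 0\<close>.
\<close>

section \<open>Closure properties of \<open>C^k\<close> maps\<close>

lemma Ck_on_Suc_has_derivative:
  assumes "Ck_on (Suc k) f S" "x \<in> S"
  shows "(f has_derivative frechet_derivative f (at x)) (at x)"
  using assms by (simp add: frechet_derivative_works)

text \<open>Openness of the domain matters: derivatives at a point see a whole neighbourhood.\<close>

lemma Ck_on_cong:
  assumes "open S" "\<And>x. x \<in> S \<Longrightarrow> f x = g x" "Ck_on k f S"
  shows "Ck_on k g S"
  using assms(2,3)
proof (induction k arbitrary: f g)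
  case 0
  then show ?case by (simp cong: continuous_on_cong)
next
  case (Suc k)
  have der: "(g has_derivative frechet_derivative f (at x)) (at x)" if "x \<in> S" for x
    using Ck_on_Suc_has_derivative[OF Suc.prems(2) that] assms(1) that Suc.prems(1)
    by (rule has_derivative_transform_within_open)
  have eq: "frechet_derivative f (at x) v = frechet_derivative g (at x) v" if "x \<in> S" for x v
    using frechet_derivative_at[OF der[OF that]] by simp
  have "Ck_on k (\<lambda>x. frechet_derivative g (at x) v) S" for v
    by (rule Suc.IH[of "\<lambda>x. frechet_derivative f (at x) v"]) (use Suc.prems(2) eq in auto)
  then show ?case
    using der by (auto simp: differentiable_def)
qed

text \<open>The derivative in the definition of \<open>C^k\<close> is a choice operator; this rule replaces it by any
  family of derivatives that is known explicitly, so that it serves as the introduction rule from here on.\<close>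

lemma Ck_on_SucI:
  assumes "open S" and der: "\<And>x. x \<in> S \<Longrightarrow> (f has_derivative f' x) (at x)"
    and "\<And>v. Ck_on k (\<lambda>x. f' x v) S"
  shows "Ck_on (Suc k) f S"
proof -
  have "Ck_on k (\<lambda>x. frechet_derivative f (at x) v) S" for v
    by (rule Ck_on_cong[OF assms(1), where f = "\<lambda>x. f' x v"])
      (use assms(3) frechet_derivative_at[OF der] in auto)
  then show ?thesis
    unfolding Ck_on.simps differentiable_def using der by blast
qed

lemma Ck_on_subset: "Ck_on k f S \<Longrightarrow> T \<subseteq> S \<Longrightarrow> Ck_on k f T"
proof (induction k arbitrary: f)
  case 0
  then show ?case by (auto intro: continuous_on_subset)
qed auto

lemma Ck_on_pred: "Ck_on (Suc k) f S \<Longrightarrow> Ck_on k f S"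
proof (induction k arbitrary: f)
  case 0
  then show ?case
    by (auto intro!: continuous_at_imp_continuous_on differentiable_imp_continuous_within)
next
  case (Suc k)
  then show ?case by (metis Ck_on.simps(2))
qed

lemma Ck_on_const: "Ck_on k (\<lambda>x. c) S"
proof (induction k arbitrary: c)
  case (Suc k)
  then show ?case
    using frechet_derivative_at[OF has_derivative_const, symmetric] by simp
qed simp

lemma Ck_on_bounded_linear:
  assumes "bounded_linear L"
  shows "Ck_on k L S"
proof (cases k)
  case 0
  then show ?thesis
    by (simp add: assms linear_continuous_on)
next
  case (Suc j)
  have "Ck_on (Suc j) L UNIV"
    by (rule Ck_on_SucI[where f' = "\<lambda>x. L"])
      (auto simp: Ck_on_const bounded_linear_imp_has_derivative[OF assms])
  then show ?thesis
    using Suc Ck_on_subset by blast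
qed

lemma Ck_on_id: "Ck_on k (\<lambda>x. x) S"
  by (rule Ck_on_bounded_linear) (rule bounded_linear_ident)

lemma Ck_on_add:
  assumes "open S" "Ck_on k f S" "Ck_on k g S"
  shows "Ck_on k (\<lambda>x. f x + g x) S"
  using assms(2,3)
proof (induction k arbitrary: f g)
  case 0
  then show ?case by (simp add: continuous_on_add)
next
  case (Suc k)
  show ?case
    by (rule Ck_on_SucI[OF assms(1) has_derivative_add[OF
          Ck_on_Suc_has_derivative[OF Suc.prems(1)] Ck_on_Suc_has_derivative[OF Suc.prems(2)]]])
      (use Suc in auto)
qed

lemma Ck_on_sum:
  assumes "open S" "\<And>i. i \<in> I \<Longrightarrow> Ck_on k (f i) S"
  shows "Ck_on k (\<lambda>x. \<Sum>i\<in>I. f i x) S"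
  using assms(2)
  by (induction I rule: infinite_finite_induct)
    (simp_all add: Ck_on_const Ck_on_add[OF assms(1)])

lemma Ck_on_bilinear:
  assumes "open S" "bounded_bilinear B" "Ck_on k f S" "Ck_on k g S"
  shows "Ck_on k (\<lambda>x. B (f x) (g x)) S"
  using assms(3,4)
proof (induction k arbitrary: f g)
  case 0
  then show ?case by (simp add: bounded_bilinear.continuous_on[OF assms(2)])
next
  case (Suc k)
  show ?case
  proof (rule Ck_on_SucI[OF assms(1) bounded_bilinear.FDERIV[OF assms(2)
          Ck_on_Suc_has_derivative[OF Suc.prems(1)] Ck_on_Suc_has_derivative[OF Suc.prems(2)]]])
    show "Ck_on k (\<lambda>x. B (f x) (frechet_derivative g (at x) v) +
        B (frechet_derivative f (at x) v) (g x)) S" for v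
      using Suc.prems by (intro Ck_on_add Suc.IH assms(1)) (auto intro: Ck_on_pred)
  qed
qed

lemmas Ck_on_mult = Ck_on_bilinear[OF _ bounded_bilinear_mult]
lemmas Ck_on_scaleR = Ck_on_bilinear[OF _ bounded_bilinear_scaleR]

text \<open>By the chain rule the derivative of the composite is \<open>Df(g x)(Dg x v)\<close>, in which the argument of \<open>Df\<close>
  depends on \<open>x\<close> twice. Expanding \<open>Dg x v\<close> in the standard basis separates the two dependences and
  leaves a sum of products of maps to which the induction hypothesis applies.\<close>

lemma Ck_on_compose:
  assumes "open S" "Ck_on k f T" "Ck_on k g S" "g ` S \<subseteq> T"
  shows "Ck_on k (\<lambda>x. f (g x)) S"
  using assms(2,3)
proof (induction k arbitrary: f)
  case 0
  then show ?case
    using assms(4) by (simp add: continuous_on_compose2)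
next
  case (Suc k)
  let ?D = "\<lambda>x v. frechet_derivative f (at (g x)) (frechet_derivative g (at x) v)"
  have in_T: "g x \<in> T" if "x \<in> S" for x
    using that assms(4) by auto
  have expand: "?D x v =
      (\<Sum>b\<in>Basis. (frechet_derivative g (at x) v \<bullet> b) *\<^sub>R frechet_derivative f (at (g x)) b)"
    if "x \<in> S" for x v
  proof -
    have "linear (frechet_derivative f (at (g x)))"
      using Ck_on_Suc_has_derivative[OF Suc.prems(1) in_T[OF that]] has_derivative_linear by blast
    then have "frechet_derivative f (at (g x)) (\<Sum>b\<in>Basis. (v' \<bullet> b) *\<^sub>R b) =
        (\<Sum>b\<in>Basis. (v' \<bullet> b) *\<^sub>R frechet_derivative f (at (g x)) b)" for v'
      by (simp add: linear_sum linear_scale)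
    from this[of "frechet_derivative g (at x) v"] show ?thesis
      unfolding euclidean_representation .
  qed
  show ?case
  proof (rule Ck_on_SucI[OF assms(1), where f' = ?D])
    show "((\<lambda>x. f (g x)) has_derivative ?D x) (at x)" if "x \<in> S" for x
      using has_derivative_compose[OF Ck_on_Suc_has_derivative[OF Suc.prems(2) that]
          Ck_on_Suc_has_derivative[OF Suc.prems(1) in_T[OF that]]] .
    have "Ck_on k (\<lambda>x. frechet_derivative f (at (g x)) b) S" for b
      using Suc.IH[of "\<lambda>y. frechet_derivative f (at y) b"] Suc.prems Ck_on_pred by auto
    moreover have "Ck_on k (\<lambda>x. frechet_derivative g (at x) v) S" for v
      using Suc.prems by simp
    ultimately have "Ck_on k (\<lambda>x. \<Sum>b\<in>Basis.
        (frechet_derivative g (at x) v \<bullet> b) *\<^sub>R frechet_derivative f (at (g x)) b) S" for v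
      by (intro Ck_on_sum Ck_on_scaleR Ck_on_bilinear[OF _ bounded_bilinear_inner] Ck_on_const
          assms(1))
    then show "Ck_on k (\<lambda>x. ?D x v) S" for v
      by (rule Ck_on_cong[OF assms(1) expand[symmetric], rotated])
  qed
qed

lemma Ck_on_compose_linear:
  assumes "open S" "bounded_linear L" "Ck_on k f S"
  shows "Ck_on k (\<lambda>x. L (f x)) S"
  using Ck_on_compose[OF assms(1) Ck_on_bounded_linear[OF assms(2), where S = UNIV] assms(3)] by simp

lemma Ck_on_inverse:
  fixes f :: "'a::euclidean_space \<Rightarrow> real"
  assumes "open S" "Ck_on k f S" "\<And>x. x \<in> S \<Longrightarrow> f x \<noteq> 0"
  shows "Ck_on k (\<lambda>x. inverse (f x)) S"
  using assms(2)
proof (induction k)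
  case 0
  then show ?case using assms(3) by (simp add: continuous_on_inverse)
next
  case (Suc k)
  show ?case
  proof (rule Ck_on_SucI[OF assms(1) Deriv.has_derivative_inverse[OF assms(3)
          Ck_on_Suc_has_derivative[OF Suc.prems]]])
    have "Ck_on k (\<lambda>x. (-1) * (inverse (f x) * frechet_derivative f (at x) v * inverse (f x))) S" for v
      using Suc.prems Ck_on_pred[OF Suc.prems]
      by (intro Ck_on_mult Ck_on_const Suc.IH assms(1)) auto
    then show "Ck_on k (\<lambda>x. - (inverse (f x) * frechet_derivative f (at x) v * inverse (f x))) S" for v
      by simp
  qed
qed

lemma Ck_on_prod:
  fixes f :: "'i \<Rightarrow> 'a::euclidean_space \<Rightarrow> real"
  assumes "open S" "\<And>i. i \<in> I \<Longrightarrow> Ck_on k (f i) S"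
  shows "Ck_on k (\<lambda>x. \<Prod>i\<in>I. f i x) S"
  using assms(2)
  by (induction I rule: infinite_finite_induct)
    (simp_all add: Ck_on_const Ck_on_mult[OF assms(1)])

lemma Ck_on_det:
  fixes A :: "'a::euclidean_space \<Rightarrow> real^'n^'n"
  assumes "open S" "\<And>i j. Ck_on k (\<lambda>x. A x $ i $ j) S"
  shows "Ck_on k (\<lambda>x. det (A x)) S"
  unfolding det_def
  by (intro Ck_on_sum Ck_on_mult Ck_on_prod Ck_on_const assms)

lemma Ck_on_vec_lambda:
  fixes f :: "'n::finite \<Rightarrow> 'a::euclidean_space \<Rightarrow> real"
  assumes "open S" "\<And>i. Ck_on k (f i) S"
  shows "Ck_on k (\<lambda>x. \<chi> i. f i x) S"
proof -
  have "(\<lambda>x. \<chi> i. f i x) = (\<lambda>x. \<Sum>i\<in>UNIV. f i x *\<^sub>R axis i 1)"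
    by (simp add: fun_eq_iff vec_eq_iff axis_def if_distrib cong: if_cong)
  moreover have "Ck_on k (\<lambda>x. \<Sum>i\<in>UNIV. f i x *\<^sub>R axis i 1) S"
    by (intro Ck_on_sum Ck_on_scaleR Ck_on_const assms)
  ultimately show ?thesis by simp
qed

lemma Ck_on_Pair:
  assumes "open S" "Ck_on k f S" "Ck_on k g S"
  shows "Ck_on k (\<lambda>x. (f x, g x)) S"
proof -
  have "bounded_linear (\<lambda>x. (x, 0))" "bounded_linear (\<lambda>y. (0, y))"
    by (auto intro: bounded_linear_Pair bounded_linear_ident bounded_linear_zero)
  then have "Ck_on k (\<lambda>x. (f x, 0) + (0, g x)) S"
    using assms by (intro Ck_on_add Ck_on_compose_linear[where L = "\<lambda>x. (x, 0)"] Ck_on_compose_linear[where L = "\<lambda>y. (0, y)"])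
  then show ?thesis by simp
qed

text \<open>Cramer's rule writes the solution of a linear system as a rational function of its coefficients, so
  it is as smooth as they are. This is the regularity step of the implicit function theorem.\<close>

lemma Ck_on_linear_solution:
  fixes A :: "'a::euclidean_space \<Rightarrow> real^'n^'n"
  assumes S: "open S" and A: "\<And>i j. Ck_on k (\<lambda>x. A x $ i $ j) S"
    and b: "\<And>i. Ck_on k (\<lambda>x. b x $ i) S"
    and inj: "\<And>x d. x \<in> S \<Longrightarrow> A x *v d = 0 \<Longrightarrow> d = 0"
    and eq: "\<And>x. x \<in> S \<Longrightarrow> A x *v y x = b x"
  shows "Ck_on k y S"
proof -
  have nz: "det (A x) \<noteq> 0" if "x \<in> S" for x
    using inj[OF that] by (metis invertible_det_nz invertible_left_inverse matrix_left_invertible_ker)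
  let ?y = "\<lambda>x. \<chi> j. det (\<chi> i l. if l = j then b x $ i else A x $ i $ l) * inverse (det (A x))"
  have "Ck_on k (\<lambda>x. (\<chi> i l. if l = j then b x $ i else A x $ i $ l) $ i $ l) S" for i j l
    using A b by (cases "l = j") simp_all
  then have "Ck_on k ?y S"
    by (intro Ck_on_vec_lambda Ck_on_mult Ck_on_inverse Ck_on_det S A nz)
  then show ?thesis
    by (rule Ck_on_cong[OF S, rotated]) (use eq cramer[OF nz] in \<open>auto simp: divide_inverse\<close>)
qed

lemma Ck_on_curveI:
  fixes c :: "real \<Rightarrow> 'b::euclidean_space"
  assumes "open S" "\<And>t. t \<in> S \<Longrightarrow> (c has_vector_derivative c' t) (at t)" "Ck_on k c' S"
  shows "Ck_on (Suc k) c S"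
  by (rule Ck_on_SucI[OF assms(1), where f' = "\<lambda>t v. v *\<^sub>R c' t"])
    (use assms in \<open>auto simp: has_vector_derivative_def intro!: Ck_on_scaleR Ck_on_const\<close>)

lemma Ck_on_curveD:
  fixes c :: "real \<Rightarrow> 'b::euclidean_space"
  assumes "Ck_on (Suc k) c S"
  shows "t \<in> S \<Longrightarrow> (c has_vector_derivative frechet_derivative c (at t) 1) (at t)"
    and "Ck_on k (\<lambda>t. frechet_derivative c (at t) 1) S"
proof -
  show "(c has_vector_derivative frechet_derivative c (at t) 1) (at t)" if "t \<in> S"
  proof -
    have der: "(c has_derivative frechet_derivative c (at t)) (at t)"
      using Ck_on_Suc_has_derivative[OF assms that] .
    then have "frechet_derivative c (at t) = (\<lambda>v. v *\<^sub>R frechet_derivative c (at t) 1)"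
      by (intro ext) (metis has_derivative_linear linear_scale mult.right_neutral real_scaleR_def)
    with der show ?thesis by (metis has_vector_derivative_def)
  qed
  show "Ck_on k (\<lambda>t. frechet_derivative c (at t) 1) S"
    using assms by simp
qed

text \<open>The two statements are proved together because each function is, up to sign, the derivative of the other.\<close>

lemma Ck_on_sin_cos: "Ck_on k sin (UNIV::real set) \<and> Ck_on k cos (UNIV::real set)"
proof (induction k)
  case 0
  show ?case by (simp add: continuous_on_sin continuous_on_cos)
next
  case (Suc k)
  have "Ck_on k (\<lambda>t. - sin t :: real) UNIV"
    using Ck_on_mult[OF open_UNIV Ck_on_const[of k "-1"] conjunct1[OF Suc.IH]] by simp
  then show ?case
    using Suc.IH
    by (intro conjI Ck_on_curveI[where c = sin and c' = cos] Ck_on_curveI[where c = cos and c' = "\<lambda>t. - sin t"])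
      (simp_all add: has_real_derivative_iff_has_vector_derivative[symmetric] DERIV_sin DERIV_cos)
qed

section \<open>Smooth curves in regular level sets\<close>

text \<open>Pick a linear right inverse \<open>L\<close> of \<open>Dh\<close> with values in \<open>E\<close> and look for the curve in the form
  \<open>\<gamma> t = x + t \<eta> + L (c t)\<close>. Solving \<open>h (\<gamma> t) = 0\<close> for \<open>c\<close> means inverting
  \<open>\<Phi> (t, c) = (t, h (x + t \<eta> + L c))\<close>, whose derivative at the origin is the identity because
  \<open>Dh \<eta> = 0\<close> and \<open>Dh \<circ> L = id\<close>; the inverse function theorem then yields a differentiable \<open>c\<close>.
  Differentiating \<open>h (\<gamma> t) = 0\<close> shows that \<open>c'\<close> solves a linear system whose coefficients depend smoothly
  on \<open>\<gamma> t\<close>, hence \<open>c\<close> being \<open>C^k\<close> makes \<open>c'\<close> of class \<open>C^k\<close>, and \<open>c\<close> is smooth by bootstrapping.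
  At \<open>t = 0\<close> the same system gives \<open>c' 0 = 0\<close>, so the velocity is \<open>\<eta>\<close>.\<close>

lemma smooth_curve_in_level_set:
  fixes h :: "'a::euclidean_space \<Rightarrow> real^'q"
  assumes h: "smooth_on h UNIV" and hx: "h x = 0" and E: "subspace E"
    and onto: "frechet_derivative h (at x) ` E = UNIV"
    and \<eta>: "\<eta> \<in> E" "frechet_derivative h (at x) \<eta> = 0"
  obtains e \<gamma> where "e > 0" "smooth_on \<gamma> {-e<..<e}" "\<gamma> 0 = x"
    "(\<gamma> has_vector_derivative \<eta>) (at 0)"
    "\<And>t. t \<in> {-e<..<e} \<Longrightarrow> h (\<gamma> t) = 0 \<and> \<gamma> t - x \<in> E"
proof -
  define D where "D = (\<lambda>y. frechet_derivative h (at y))"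
  have Ck_h: "Ck_on k h UNIV" for k
    using h by (simp add: smooth_on_def)
  have der_h: "(h has_derivative D y) (at y)" for y
    unfolding D_def using Ck_on_Suc_has_derivative[OF Ck_h] by simp
  have lin_D: "linear (D y)" for y
    using der_h has_derivative_linear by blast
  have Ck_D: "Ck_on k (\<lambda>y. D y v) UNIV" for k v
    unfolding D_def using Ck_h[of "Suc k"] by simp
  have "\<exists>z. z \<in> E \<and> D x z = axis i 1" for i
    using onto unfolding D_def by (metis UNIV_I imageE)
  then obtain z where zE: "\<And>i. z i \<in> E" and Dz: "\<And>i. D x (z i) = axis i 1"
    by metis
  define L :: "real^'q \<Rightarrow> 'a" where "L = (\<lambda>c. \<Sum>i\<in>UNIV. (c $ i) *\<^sub>R z i)"
  have blin_L: "bounded_linear L"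
    unfolding L_def
    by (intro bounded_linear_sum bounded_linear_scaleR_left[THEN bounded_linear_compose]
        bounded_linear_vec_nth)
  have D_L: "D y (L d) = (\<Sum>i\<in>UNIV. (d $ i) *\<^sub>R D y (z i))" for y d
    by (simp add: L_def linear_sum[OF lin_D] linear_scale[OF lin_D])
  have D\<eta>: "D x \<eta> = 0"
    using \<eta>(2) by (simp add: D_def)
  have D_L_x: "D x (L d) = d" for d
    by (simp add: D_L Dz vec_eq_iff axis_def if_distrib cong: if_cong)
  have LE: "L d \<in> E" for d
    by (simp add: L_def E subspace_sum subspace_scale zE)
  define \<rho> where "\<rho> = (\<lambda>p::real \<times> (real^'q). x + fst p *\<^sub>R \<eta> + L (snd p))"
  define \<Phi> where "\<Phi> = (\<lambda>p::real \<times> (real^'q). (fst p, h (\<rho> p)))"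
  define \<Phi>' where "\<Phi>' = (\<lambda>p v. (fst v, D (\<rho> p) (fst v *\<^sub>R \<eta> + L (snd v))))"
  have der_\<rho>: "(\<rho> has_derivative (\<lambda>v. fst v *\<^sub>R \<eta> + L (snd v))) (at p)" for p
    unfolding \<rho>_def
    by (auto intro!: derivative_eq_intros bounded_linear.has_derivative[OF blin_L])
  have der_\<Phi>: "(\<Phi> has_derivative \<Phi>' p) (at p)" for p
    unfolding \<Phi>_def \<Phi>'_def
    by (intro has_derivative_Pair has_derivative_compose[OF der_\<rho> der_h])
      (auto intro: derivative_intros)
  have blin: "bounded_linear (\<Phi>' p)" for p
    using der_\<Phi> has_derivative_bounded_linear by blast
  have cont_\<rho>: "continuous_on UNIV \<rho>"
    using der_\<rho> by (auto intro!: continuous_at_imp_continuous_on has_derivative_continuous)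
  have "continuous_on UNIV (\<lambda>p. D (\<rho> p) w)" for w
    using continuous_on_compose2[OF _ cont_\<rho>, of UNIV "\<lambda>y. D y w"] Ck_D[of 0 w] by simp
  then have cont: "continuous_on UNIV (\<lambda>p. Blinfun (\<Phi>' p))"
    by (intro continuous_on_blinfun_componentwise, unfold bounded_linear_Blinfun_apply[OF blin])
      (simp add: \<Phi>'_def continuous_on_Pair continuous_on_const)
  have \<rho>0: "\<rho> 0 = x"
    by (simp add: \<rho>_def linear_simps[OF blin_L])
  have \<Phi>0: "\<Phi> 0 = 0"
    by (simp add: \<Phi>_def \<rho>0 hx prod_eq_iff)
  have "\<Phi>' 0 v = v" for v
    by (simp add: \<Phi>'_def \<rho>0 linear_add[OF lin_D] linear_scale[OF lin_D] D_L_x D\<eta>)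
  then have inv0: "id_blinfun o\<^sub>L Blinfun (\<Phi>' 0) = id_blinfun"
    by (intro blinfun_eqI) (simp add: bounded_linear_Blinfun_apply[OF blin[of 0]])
  obtain U V g g' where "open U" "0 \<in> U" and V: "open V" "\<Phi> 0 \<in> V" and
    hom: "homeomorphism U V \<Phi> g" and
    der_g: "\<And>y. y \<in> V \<Longrightarrow> (g has_derivative g' y) (at y)" and
    bij: "\<And>y. y \<in> V \<Longrightarrow> bij (\<Phi>' (g y))"
    using inverse_function_theorem[of UNIV \<Phi> "\<lambda>p. Blinfun (\<Phi>' p)" 0 id_blinfun] cont inv0 der_\<Phi>
    unfolding bounded_linear_Blinfun_apply[OF blin] by (metis open_UNIV UNIV_I)
  have "open ((\<lambda>t. (t, 0)) -` V)" "0 \<in> (\<lambda>t. (t, 0)) -` V"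
    using V by (auto simp: \<Phi>0[unfolded zero_prod_def] zero_prod_def
        intro!: continuous_open_vimage continuous_intros)
  then obtain e where e: "e > 0" and "ball 0 e \<subseteq> (\<lambda>t. (t, 0)) -` V"
    by (meson open_contains_ball)
  then have inV: "(t, 0) \<in> V" if "t \<in> {-e<..<e}" for t
    using that by (force simp: dist_real_def)
  let ?I = "{-e<..<e}"
  define c where "c = (\<lambda>t. snd (g (t, 0)))"
  define c' where "c' = (\<lambda>t. snd (g' (t, 0) (1, 0)))"
  define \<gamma> where "\<gamma> = (\<lambda>t. x + t *\<^sub>R \<eta> + L (c t))"
  have g_eq: "g (t, 0) = (t, c t)" and h\<gamma>: "h (\<gamma> t) = 0" if "t \<in> ?I" for t
  proof -
    have "\<Phi> (g (t, 0)) = (t, 0)"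
      using hom inV[OF that] by (auto simp: homeomorphism_def)
    then show "g (t, 0) = (t, c t)" "h (\<gamma> t) = 0"
      by (auto simp: \<Phi>_def c_def \<gamma>_def \<rho>_def prod_eq_iff)
  qed
  have c0: "c 0 = 0"
    using hom \<open>0 \<in> U\<close> \<Phi>0 by (metis c_def homeomorphism_def snd_zero zero_prod_def)
  have der_c: "(c has_vector_derivative c' t) (at t)" if "t \<in> ?I" for t
  proof -
    have "((\<lambda>t. (t, 0)) has_derivative (\<lambda>s. (s, 0))) (at t)"
      by (intro derivative_intros)
    from has_derivative_compose[OF this der_g[OF inV[OF that]]]
    have "(c has_derivative (\<lambda>s. snd (g' (t, 0) (s, 0)))) (at t)"
      unfolding c_def by (rule has_derivative_snd)
    moreover have "snd (g' (t, 0) (s, 0)) = s *\<^sub>R c' t" for s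
      using linear_scale[OF has_derivative_linear[OF der_g[OF inV[OF that]]], of s "(1, 0)"]
      by (simp add: c'_def)
    ultimately show ?thesis by (simp add: has_vector_derivative_def)
  qed
  have der_\<gamma>: "(\<gamma> has_vector_derivative \<eta> + L (c' t)) (at t)" if "t \<in> ?I" for t
    unfolding \<gamma>_def
    by (auto intro!: derivative_eq_intros bounded_linear.has_vector_derivative[OF blin_L der_c[OF that]])
  \<comment> \<open>The matrix of \<open>Dh \<circ> L\<close> at \<open>\<gamma> t\<close>, the coefficient matrix of the system for \<open>c'\<close>.\<close>
  define A :: "real \<Rightarrow> real^'q^'q" where "A = (\<lambda>t. \<chi> i j. D (\<gamma> t) (z j) $ i)"
  have A_mult: "A t *v d = D (\<gamma> t) (L d)" for t d
    by (simp add: A_def D_L matrix_vector_mult_def vec_eq_iff mult.commute)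
  have solves: "A t *v c' t = - D (\<gamma> t) \<eta>" if "t \<in> ?I" for t
  proof -
    have "((\<lambda>s. h (\<gamma> s)) has_derivative (\<lambda>s. D (\<gamma> t) (s *\<^sub>R (\<eta> + L (c' t))))) (at t)"
      using has_derivative_compose[OF der_\<gamma>[OF that, unfolded has_vector_derivative_def] der_h] .
    moreover have "((\<lambda>s. h (\<gamma> s)) has_derivative (\<lambda>s. 0)) (at t)"
      by (rule has_derivative_transform_within_open[where f = "\<lambda>s. 0" and s = ?I])
        (use that h\<gamma> in auto)
    ultimately have "(\<lambda>s. D (\<gamma> t) (s *\<^sub>R (\<eta> + L (c' t)))) = (\<lambda>s. 0)"
      by (rule has_derivative_unique)
    from fun_cong[OF this, of 1] have "D (\<gamma> t) \<eta> + D (\<gamma> t) (L (c' t)) = 0"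
      by (simp add: linear_add[OF lin_D])
    then show ?thesis
      by (simp add: A_mult eq_neg_iff_add_eq_0 add.commute)
  qed
  have inj: "d = 0" if "t \<in> ?I" "A t *v d = 0" for t d
  proof -
    have "\<rho> (g (t, 0)) = \<gamma> t"
      using g_eq[OF that(1)] by (simp add: \<rho>_def \<gamma>_def)
    then have "\<Phi>' (g (t, 0)) (0, d) = \<Phi>' (g (t, 0)) 0"
      using that(2) by (simp add: \<Phi>'_def A_mult linear_simps[OF blin_L] linear_0[OF lin_D])
    then have "(0::real, d) = 0"
      using bij[OF inV[OF that(1)]] by (meson bij_def injD)
    then show ?thesis by (simp add: zero_prod_def)
  qed
  have Ck_\<gamma>: "Ck_on k \<gamma> ?I" if "Ck_on k c ?I" for k
    unfolding \<gamma>_def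
    by (intro Ck_on_add Ck_on_scaleR Ck_on_id Ck_on_const Ck_on_compose_linear[OF _ blin_L] that) auto
  have Ck_c: "Ck_on k c ?I" for k
  proof (induction k)
    case 0
    then show ?case
      using der_c has_vector_derivative_continuous
      by (fastforce intro!: continuous_at_imp_continuous_on)
  next
    case (Suc k)
    have "Ck_on k (\<lambda>t. D (\<gamma> t) w $ i) ?I" for w i
      by (intro Ck_on_compose_linear[OF _ bounded_linear_vec_nth] Ck_on_compose[OF _ Ck_D]
          Ck_\<gamma> Suc.IH) auto
    moreover have "Ck_on k (\<lambda>t. (- D (\<gamma> t) \<eta>) $ i) ?I" for i
      using Ck_on_mult[OF _ Ck_on_const[of k "-1"] calculation] by simp
    ultimately have "Ck_on k c' ?I"
      by (intro Ck_on_linear_solution[where A = A and b = "\<lambda>t. - D (\<gamma> t) \<eta>"])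
        (use solves inj in \<open>auto simp: A_def\<close>)
    then show ?case
      using der_c by (intro Ck_on_curveI) auto
  qed
  show thesis
  proof
    show "e > 0" by fact
    show "smooth_on \<gamma> ?I"
      using Ck_\<gamma> Ck_c by (simp add: smooth_on_def)
    show \<gamma>0: "\<gamma> 0 = x"
      by (simp add: \<gamma>_def c0 linear_simps[OF blin_L])
    have "c' 0 = 0"
      using solves[of 0] D\<eta> e by (simp add: A_mult \<gamma>0 D_L_x)
    then show "(\<gamma> has_vector_derivative \<eta>) (at 0)"
      using der_\<gamma>[of 0] e by (simp add: linear_simps[OF blin_L])
    show "h (\<gamma> t) = 0 \<and> \<gamma> t - x \<in> E" if "t \<in> ?I" for t
      using h\<gamma>[OF that] E \<eta>(1) LE by (simp add: \<gamma>_def subspace_add subspace_scale)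
  qed
qed

section \<open>Matrices, orthogonal projectors and plane rotations\<close>

definition outer :: "real^'m \<Rightarrow> real^'n \<Rightarrow> real^'n^'m" where
  "outer a b = (\<chi> i j. a $ i * b $ j)"

lemma outer_mult_outer: "outer a b ** outer c d = (b \<bullet> c) *\<^sub>R outer a d"
  by (simp add: outer_def matrix_matrix_mult_def inner_vec_def vec_eq_iff sum_distrib_left sum_distrib_right mult_ac)

lemma matrix_mult_outer: "X ** outer a b = outer (X *v a) b"
  by (simp add: outer_def matrix_matrix_mult_def matrix_vector_mult_def vec_eq_iff sum_distrib_left sum_distrib_right mult_ac)

lemma outer_mult_matrix: "outer a b ** X = outer a (transpose X *v b)"
  by (simp add: outer_def matrix_matrix_mult_def matrix_vector_mult_def transpose_def vec_eq_iff sum_distrib_left mult_ac)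

lemma transpose_outer [simp]: "transpose (outer a b) = outer b a"
  by (simp add: outer_def transpose_def vec_eq_iff mult.commute)

lemma outer_zero [simp]: "outer 0 b = 0" "outer a 0 = 0"
  by (simp_all add: outer_def vec_eq_iff)

lemma bounded_bilinear_matrix_mult: "bounded_bilinear ((**) :: real^'k^'m \<Rightarrow> real^'n^'k \<Rightarrow> real^'n^'m)"
  unfolding bilinear_conv_bounded_bilinear[symmetric] bilinear_def
  by (auto intro!: linearI simp: matrix_matrix_mult_def vec_eq_iff sum.distrib sum_distrib_left
      algebra_simps)

lemmas matrix_mult_simps =
  bounded_bilinear.add_left[OF bounded_bilinear_matrix_mult]
  bounded_bilinear.add_right[OF bounded_bilinear_matrix_mult]
  bounded_bilinear.diff_left[OF bounded_bilinear_matrix_mult]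
  bounded_bilinear.diff_right[OF bounded_bilinear_matrix_mult]
  bounded_bilinear.minus_left[OF bounded_bilinear_matrix_mult]
  bounded_bilinear.minus_right[OF bounded_bilinear_matrix_mult]
  bounded_bilinear.scaleR_left[OF bounded_bilinear_matrix_mult]
  bounded_bilinear.scaleR_right[OF bounded_bilinear_matrix_mult]
  bounded_bilinear.zero_left[OF bounded_bilinear_matrix_mult]
  bounded_bilinear.zero_right[OF bounded_bilinear_matrix_mult]

lemma bounded_linear_transpose: "bounded_linear (transpose :: real^'n^'m \<Rightarrow> real^'m^'n)"
  unfolding linear_conv_bounded_linear[symmetric]
  by (auto intro!: linearI simp: transpose_def vec_eq_iff)

text \<open>Most comparisons of ranks below exhibit such an injection.\<close>

lemma linear_inj_dim_le:
  fixes f :: "'a::euclidean_space \<Rightarrow> 'b::euclidean_space"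
  assumes "linear f" "subspace S" "\<And>x. x \<in> S \<Longrightarrow> f x = 0 \<Longrightarrow> x = 0" "f ` S \<subseteq> T"
  shows "dim S \<le> dim T"
proof -
  have "inj_on f (span S)"
    unfolding span_eq_iff[THEN iffD2, OF assms(2)]
    using linear_injective_on_subspace_0[OF assms(1,2)] assms(3) by blast
  then have "dim (f ` S) = dim S"
    by (rule dim_image_eq[OF assms(1)])
  then show ?thesis
    using dim_subset[OF assms(4)] by simp
qed

definition orth_projector :: "real^'n^'n \<Rightarrow> bool" where
  "orth_projector G \<longleftrightarrow> transpose G = G \<and> G ** G = G"

lemma Gr_iff: "G \<in> Gr k \<longleftrightarrow> orth_projector G \<and> rank G = k"
  by (auto simp: Gr_def Sym_def orth_projector_def)

lemma orth_projector_apply_range: "orth_projector G \<Longrightarrow> y \<in> range ((*v) G) \<Longrightarrow> G *v y = y"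
  by (auto simp: orth_projector_def matrix_vector_mul_assoc)

lemma inner_matrix_vector_transpose: "(A *v x) \<bullet> y = x \<bullet> (transpose A *v (y::real^'m))"
  using dot_lmul_matrix[of y A x] by (simp add: inner_commute)

lemma norm_orth_projector_le:
  assumes "orth_projector G"
  shows "norm (G *v x) \<le> norm x"
proof -
  have "norm (G *v x) * norm (G *v x) = (G *v x) \<bullet> x"
    using assms inner_matrix_vector_transpose[of G x "G *v x"]
    unfolding orth_projector_def
    by (simp only: matrix_vector_mul_assoc inner_commute flip: norm_eq_sqrt_inner power2_eq_square power2_norm_eq_inner)
  also have "\<dots> \<le> norm (G *v x) * norm x"
    by (rule norm_cauchy_schwarz)
  finally show ?thesis
    by (cases "norm (G *v x) = 0") (auto simp: mult_le_cancel_left)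
qed

text \<open>A projector \<open>G\<close> fixes its range. A vector of the range killed by \<open>K\<close> would be fixed
  by \<open>G - K\<close>, which is impossible if \<open>G - K\<close> shrinks every vector. So \<open>K\<close> is injective on the range of
  \<open>G\<close>. Used in both directions, this makes the rank locally constant on the set of projectors.\<close>

lemma rank_orth_projector_le:
  assumes G: "orth_projector G" and K: "\<And>x. x \<noteq> 0 \<Longrightarrow> norm ((G - K) *v x) < norm x"
  shows "rank G \<le> rank K"
  unfolding rank_dim_range
proof (rule linear_inj_dim_le[where f = "(*v) K"])
  show "subspace (range ((*v) G))"
    by (intro linear_subspace_image subspace_UNIV) simp
  show "x = 0" if "x \<in> range ((*v) G)" "K *v x = 0" for x
    using orth_projector_apply_range[OF G that(1)] that(2) K[of x]
    by (auto simp: matrix_vector_mult_diff_rdistrib)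
qed auto

text \<open>Projectors are contractions, hence bounded. The equations are closed conditions, and so is the rank
  condition because the rank is locally constant on projectors.\<close>

lemma compact_Gr: "compact (Gr k :: (real^'n^'n) set)"
proof -
  have "norm (G :: real^'n^'n) \<le> real CARD('n)" if "G \<in> Gr k" for G
  proof -
    have "norm G \<le> (\<Sum>j\<in>UNIV. norm (G $ j))"
      unfolding norm_vec_def by (rule L2_set_le_sum) simp
    also have "\<dots> = (\<Sum>j\<in>UNIV. norm (G *v axis j 1))"
      using that unfolding Gr_iff orth_projector_def
      by (metis (no_types, lifting) column_transpose matrix_vector_mult_basis row_def vec_lambda_eta)
    also have "\<dots> \<le> (\<Sum>j\<in>(UNIV::'n set). 1)"
      using that norm_orth_projector_le[of G "axis _ 1"] by (intro sum_mono) (auto simp: Gr_iff)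
    finally show ?thesis by simp
  qed
  then have bdd: "bounded (Gr k :: (real^'n^'n) set)"
    by (auto simp: bounded_iff)
  have "closed (Gr k :: (real^'n^'n) set)"
    unfolding closed_sequential_limits
  proof (intro allI impI, elim conjE)
    fix Gs :: "nat \<Rightarrow> real^'n^'n" and G
    assume Gs: "\<forall>i. Gs i \<in> Gr k" and lim: "Gs \<longlonglongrightarrow> G"
    have "(\<lambda>i. transpose (Gs i)) \<longlonglongrightarrow> transpose G" "(\<lambda>i. Gs i ** Gs i) \<longlonglongrightarrow> G ** G"
      using lim by (auto intro: bounded_linear.tendsto[OF bounded_linear_transpose]
          bounded_bilinear.tendsto[OF bounded_bilinear_matrix_mult])
    then have G: "orth_projector G"
      using Gs lim by (auto simp: Gr_iff orth_projector_def intro: LIMSEQ_unique)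
    have "(\<lambda>i. onorm ((*v) (Gs i - G))) \<longlonglongrightarrow> 0"
    proof (rule tendsto_sandwich)
      show "\<forall>\<^sub>F i in sequentially. 0 \<le> onorm ((*v) (Gs i - G))"
        by (simp add: onorm_pos_le)
      show "\<forall>\<^sub>F i in sequentially. onorm ((*v) (Gs i - G)) \<le> (\<Sum>a\<in>UNIV. \<Sum>b\<in>UNIV. \<bar>(Gs i - G) $ a $ b\<bar>)"
        by (simp only: onorm_le_matrix_component_sum eventually_True)
      have "(\<lambda>i. \<Sum>a\<in>UNIV. \<Sum>b\<in>UNIV. \<bar>(Gs i - G) $ a $ b\<bar>) \<longlonglongrightarrow>
          (\<Sum>a\<in>UNIV. \<Sum>b\<in>UNIV. \<bar>(G - G) $ a $ b\<bar>)"
        by (intro tendsto_intros lim)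
      then show "(\<lambda>i. \<Sum>a\<in>UNIV. \<Sum>b\<in>UNIV. \<bar>(Gs i - G) $ a $ b\<bar>) \<longlonglongrightarrow> 0"
        by simp
    qed simp
    then have "\<forall>\<^sub>F i in sequentially. onorm ((*v) (Gs i - G)) < 1"
      by (rule order_tendstoD(2)) simp
    then obtain i where i: "onorm ((*v) (Gs i - G)) < 1"
      using eventually_happens'[OF sequentially_bot] by blast
    have small: "norm ((Gs i - G) *v x) < norm x" if "x \<noteq> 0" for x
    proof -
      have "norm ((Gs i - G) *v x) \<le> onorm ((*v) (Gs i - G)) * norm x"
        by (rule onorm) simp
      also have "\<dots> < 1 * norm x"
        using i that by (intro mult_strict_right_mono) auto
      finally show ?thesis by simp
    qed
    have "norm ((G - Gs i) *v x) < norm x" if "x \<noteq> 0" for x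
      using small[OF that] by (simp add: matrix_vector_mult_diff_rdistrib norm_minus_commute)
    then have "rank G = k"
      using rank_orth_projector_le[OF G, of "Gs i"] rank_orth_projector_le[of "Gs i" G] small Gs
      by (simp add: Gr_iff order_antisym)
    then show "G \<in> Gr k"
      using G by (simp add: Gr_iff)
  qed
  with bdd show ?thesis by (simp add: compact_eq_bounded_closed)
qed

lemma rank_transpose_orthogonal_conjugate:
  fixes Q G :: "real^'n^'n"
  assumes "orthogonal_matrix Q"
  shows "rank (transpose Q ** G ** Q) = rank G"
proof (rule antisym)
  show "rank (transpose Q ** G ** Q) \<le> rank G"
    by (rule order_trans[OF rank_mul_le_left rank_mul_le_right])
  have "Q ** (transpose Q ** G ** Q) ** transpose Q = (Q ** transpose Q) ** G ** (Q ** transpose Q)"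
    by (simp add: matrix_mul_assoc)
  then have "G = Q ** (transpose Q ** G ** Q) ** transpose Q"
    using assms by (simp add: orthogonal_matrix_def)
  then show "rank G \<le> rank (transpose Q ** G ** Q)"
    using order_trans[OF rank_mul_le_left rank_mul_le_right, of Q "transpose Q ** G ** Q" "transpose Q"]
    by simp
qed

lemma orthogonal_conjugate_Gr:
  fixes Q G :: "real^'n^'n"
  assumes "orthogonal_matrix Q" "G \<in> Gr k"
  shows "transpose Q ** G ** Q \<in> Gr k"
proof -
  have "transpose Q ** G ** Q ** (transpose Q ** G ** Q) = transpose Q ** G ** (Q ** transpose Q) ** G ** Q"
    by (simp add: matrix_mul_assoc)
  also have "\<dots> = transpose Q ** (G ** G) ** Q"
    using assms(1) by (simp add: orthogonal_matrix_def matrix_mul_assoc)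
  also have "G ** G = G"
    using assms(2) by (simp add: Gr_iff orth_projector_def)
  finally show ?thesis
    using assms rank_transpose_orthogonal_conjugate[OF assms(1), of G]
    by (simp add: Gr_iff orth_projector_def matrix_transpose_mul matrix_mul_assoc)
qed

text \<open>The rotation by the angle \<open>t\<close> in the plane of two orthonormal vectors \<open>w\<close> and \<open>u\<close>, that is, the
  exponential of \<open>t\<close> times the skew matrix \<open>outer w u - outer u w\<close>.\<close>

definition plane_rotation :: "real^'n \<Rightarrow> real^'n \<Rightarrow> real \<Rightarrow> real^'n^'n" where
  "plane_rotation w u t = mat 1 + (cos t - 1) *\<^sub>R (outer w w + outer u u) + sin t *\<^sub>R (outer w u - outer u w)"

lemma plane_rotation_0 [simp]: "plane_rotation w u 0 = mat 1"
  by (simp add: plane_rotation_def)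

lemma orthogonal_plane_rotation:
  assumes "norm w = 1" "norm u = 1" "w \<bullet> u = 0"
  shows "orthogonal_matrix (plane_rotation w u t)"
proof -
  define P where "P = outer w w + outer u u"
  define A where "A = outer w u - outer u w"
  define c where "c = cos t - 1"
  define s where "s = sin t"
  have inner: "w \<bullet> w = 1" "u \<bullet> u = 1" "w \<bullet> u = 0" "u \<bullet> w = 0"
    using assms by (simp_all add: dot_square_norm inner_commute)
  have PP: "P ** P = P" and AA: "A ** A = - P" and PA: "P ** A = A" and AP: "A ** P = A"
    by (simp_all add: P_def A_def matrix_mult_simps outer_mult_outer inner)
  have T: "transpose (plane_rotation w u t) = mat 1 + c *\<^sub>R P - s *\<^sub>R A"
    by (simp add: plane_rotation_def P_def A_def c_def s_def transpose_def outer_def mat_def vec_eq_iff algebra_simps)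
  have "transpose (plane_rotation w u t) ** plane_rotation w u t =
      (mat 1 + c *\<^sub>R P - s *\<^sub>R A) ** (mat 1 + c *\<^sub>R P + s *\<^sub>R A)"
    unfolding T by (simp add: plane_rotation_def P_def A_def c_def s_def)
  also have "\<dots> = mat 1 + (c + c + c * c + s * s) *\<^sub>R P"
    by (simp add: matrix_mult_simps PP AA PA AP vec_eq_iff algebra_simps)
  also have "c + c + c * c + s * s = 0"
    using sin_cos_squared_add[of t] by (simp add: c_def s_def power2_eq_square algebra_simps)
  finally show ?thesis
    by (simp add: orthogonal_matrix)
qed

lemma Ck_on_plane_rotation: "Ck_on k (\<lambda>t. plane_rotation w u (K * t)) UNIV"
proof -
  have "Ck_on k (\<lambda>t. sin (K * t)) UNIV" "Ck_on k (\<lambda>t. cos (K * t)) UNIV"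
    using Ck_on_sin_cos[of k] Ck_on_bounded_linear[OF bounded_linear_mult_right[of K], of k UNIV]
    by (auto intro: Ck_on_compose[where T = UNIV])
  moreover have "plane_rotation w u (K * t) = mat 1 + (cos (K * t) + (-1)) *\<^sub>R (outer w w + outer u u)
      + sin (K * t) *\<^sub>R (outer w u - outer u w)" for t
    by (simp add: plane_rotation_def)
  ultimately show ?thesis
    by (simp only:) (intro Ck_on_add Ck_on_scaleR Ck_on_const open_UNIV)
qed

section \<open>Ranks, kernels and tangent cones\<close>

lemma subspace_range_matrix: "subspace (range ((*v) (A :: real^'n^'m)))"
  by (intro linear_subspace_image subspace_UNIV) simp

lemma bounded_linear_matrix_vector_left: "bounded_linear (\<lambda>A :: real^'n^'m. A *v u)"
  unfolding linear_conv_bounded_linear[symmetric]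
  by (rule linearI) (simp_all add: matrix_vector_mult_add_rdistrib scaleR_matrix_vector_assoc)

text \<open>The rows of \<open>X\<close> are orthogonal to the range of \<open>G\<close>, so the sum of the row space and that range is
  direct.\<close>

lemma rank_add_orth_projector_le:
  fixes X :: "real^'n^'m" and G :: "real^'n^'n"
  assumes G: "orth_projector G" and XG: "X ** G = 0"
  shows "rank X + rank G \<le> CARD('n)"
proof -
  let ?S = "range ((*v) (transpose X)) \<times> range ((*v) G)"
  have GX: "G ** transpose X = 0"
  proof -
    have "G ** transpose X = transpose (X ** G)"
      using G by (simp add: matrix_transpose_mul orth_projector_def)
    then show ?thesis
      by (simp add: XG transpose_def vec_eq_iff)
  qed
  have "dim ?S \<le> dim (UNIV :: (real^'n) set)"
  proof (rule linear_inj_dim_le[where f = "\<lambda>p. fst p + snd p"])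
    show "linear (\<lambda>p :: (real^'n) \<times> (real^'n). fst p + snd p)"
      by (rule linearI) (simp_all add: scaleR_add_right add_ac)
    show "subspace ?S"
      by (intro subspace_Times subspace_range_matrix)
    show "p = 0" if "p \<in> ?S" "fst p + snd p = 0" for p
    proof -
      have "G *v fst p = 0"
        using that(1) GX by (auto simp: matrix_vector_mul_assoc simp del: transpose_matrix_vector)
      moreover have "G *v snd p = snd p"
        using that(1) by (intro orth_projector_apply_range[OF G]) (simp add: mem_Times_iff)
      moreover have "G *v (fst p + snd p) = 0"
        using that(2) by simp
      ultimately have "snd p = 0"
        by (simp add: matrix_vector_right_distrib)
      then show ?thesis
        using that(2) by (simp add: prod_eq_iff)
    qed
  qed simp
  then show ?thesis
    using rank_transpose[of X]
    by (simp add: dim_Times subspace_range_matrix rank_dim_range del: transpose_matrix_vector)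
qed

lemma common_kernel_vector:
  fixes X :: "real^'n^'m" and G :: "real^'n^'k"
  assumes "rank X + rank G < CARD('n)"
  obtains w where "w \<noteq> 0" "X *v w = 0" "G *v w = 0"
proof (rule ccontr)
  assume none: "\<not> thesis"
  let ?T = "range ((*v) X) \<times> range ((*v) G)"
  have "dim (UNIV :: (real^'n) set) \<le> dim ?T"
  proof (rule linear_inj_dim_le[where f = "\<lambda>w. (X *v w, G *v w)"])
    show "linear (\<lambda>w. (X *v w, G *v w))"
      by (rule linearI) (simp_all add: matrix_vector_right_distrib matrix_vector_mult_scaleR)
    show "w = 0" if "(X *v w, G *v w) = 0" for w
      using that none \<open>\<And>w. \<lbrakk>w \<noteq> 0; X *v w = 0; G *v w = 0\<rbrakk> \<Longrightarrow> thesis\<close> by (auto simp: prod_eq_iff)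
  qed auto
  then show False
    using assms by (simp add: dim_Times subspace_range_matrix rank_dim_range)
qed

lemma tangent_cone_mono: "S \<subseteq> T \<Longrightarrow> tangent_cone S x \<subseteq> tangent_cone T x"
  unfolding tangent_cone_def by blast

text \<open>The points of a tangent sequence converge because the step sizes vanish while the difference
  quotients stay bounded.\<close>

lemma tangent_coneE:
  assumes "\<eta> \<in> tangent_cone S x"
  obtains X t where "\<And>k. X k \<in> S" "\<And>k::nat. t k > (0::real)" "X \<longlonglongrightarrow> x"
    "(\<lambda>k. (X k - x) /\<^sub>R t k) \<longlonglongrightarrow> \<eta>"
proof -
  obtain X t where X: "\<And>k. X k \<in> S" "\<And>k::nat. t k > (0::real)" "t \<longlonglongrightarrow> 0"
    "(\<lambda>k. (X k - x) /\<^sub>R t k) \<longlonglongrightarrow> \<eta>"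
    using assms unfolding tangent_cone_def by blast
  have "(\<lambda>k. t k *\<^sub>R ((X k - x) /\<^sub>R t k)) \<longlonglongrightarrow> 0 *\<^sub>R \<eta>"
    by (intro tendsto_intros X)
  moreover have "t k *\<^sub>R ((X k - x) /\<^sub>R t k) = X k - x" for k
    using X(2)[of k] by simp
  ultimately have "X \<longlonglongrightarrow> x"
    by (simp add: LIM_zero_iff)
  then show thesis
    using X that by blast
qed

lemma derivative_vanishes_on_tangent_cone:
  fixes h :: "'a::euclidean_space \<Rightarrow> 'b::euclidean_space"
  assumes der: "(h has_derivative D) (at x)" and "h x = 0"
    and "\<eta> \<in> tangent_cone {y. h y = 0} x"
  shows "D \<eta> = 0"
proof -
  obtain X t where "\<And>k. X k \<in> {y. h y = 0}" and X: "\<And>k::nat. t k > (0::real)" "X \<longlonglongrightarrow> x"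
    and lim: "(\<lambda>k. (X k - x) /\<^sub>R t k) \<longlonglongrightarrow> \<eta>"
    by (rule tangent_coneE[OF assms(3)]) blast
  then have hX: "h (X k) = 0" for k
    by simp
  have bl: "bounded_linear D"
    using der by (rule has_derivative_bounded_linear)
  have "norm (D \<eta>) \<le> e * norm \<eta>" if "e > 0" for e
  proof -
    have "\<exists>d>0. \<forall>y. norm (y - x) < d \<longrightarrow> norm (h y - h x - D (y - x)) \<le> e * norm (y - x)"
      using der that by (simp add: has_derivative_at_alt)
    then obtain d where d: "d > 0" "\<And>y. norm (y - x) < d \<Longrightarrow> norm (h y - h x - D (y - x)) \<le> e * norm (y - x)"
      by blast
    have "\<forall>\<^sub>F k in sequentially. dist (X k) x < d"
      using X(2) d(1) by (rule tendstoD)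
    then have ev: "\<forall>\<^sub>F k in sequentially. norm (D ((X k - x) /\<^sub>R t k)) \<le> e * norm ((X k - x) /\<^sub>R t k)"
    proof (rule eventually_mono)
      fix k assume "dist (X k) x < d"
      then have "norm (D (X k - x)) \<le> e * norm (X k - x)"
        using d(2)[of "X k"] hX[of k] \<open>h x = 0\<close> by (simp add: dist_norm)
      then have "inverse (t k) * norm (D (X k - x)) \<le> inverse (t k) * (e * norm (X k - x))"
        using X(1)[of k] by (intro mult_left_mono) auto
      then show "norm (D ((X k - x) /\<^sub>R t k)) \<le> e * norm ((X k - x) /\<^sub>R t k)"
        using X(1)[of k] by (simp add: linear_simps(5)[OF bl] mult_ac)
    qed
    show ?thesis
      by (rule tendsto_le[OF sequentially_bot _ _ ev]; intro tendsto_intros bounded_linear.tendsto[OF bl] lim)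
  qed
  then have "norm (D \<eta>) \<le> 0 + e" if "e > 0" for e
  proof -
    have "norm (D \<eta>) \<le> e / (1 + norm \<eta>) * norm \<eta>"
      using that by (intro \<open>\<And>e. e > 0 \<Longrightarrow> norm (D \<eta>) \<le> e * norm \<eta>\<close> divide_pos_pos) (auto simp: add_pos_nonneg)
    also have "\<dots> \<le> e"
      using that by (simp add: divide_le_eq add_pos_nonneg distrib_left)
    finally show ?thesis by simp
  qed
  then have "norm (D \<eta>) \<le> 0"
    by (rule field_le_epsilon)
  then show ?thesis by simp
qed

text \<open>At a matrix of maximal rank the rank cannot increase to first order. Let \<open>Y k\<close> be matrices of rank at
  most that of \<open>X\<close> whose difference quotients \<open>E k\<close> converge to \<open>\<eta>\<close>. As \<open>X u = 0\<close>, the vector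
  \<open>E k u\<close> lies in the range of \<open>Y k\<close>. If \<open>\<eta> u\<close> were outside the range of \<open>X\<close>, the map
  \<open>(v, c) \<mapsto> X v + c \<eta> u\<close> would be injective on the product of the row space of \<open>X\<close> with the line. Injectivity
  survives small perturbations, so for large \<open>k\<close> the map \<open>(v, c) \<mapsto> Y k v + c E k u\<close> would be injective with values
  in the range of \<open>Y k\<close>, which is too small for that.\<close>

lemma tangent_cone_bounded_rank:
  fixes X :: "real^'n^'m"
  assumes \<eta>: "\<eta> \<in> tangent_cone (bounded_rank (rank X)) X" and Xu: "X *v u = 0"
  shows "\<eta> *v u \<in> range ((*v) X)"
proof (rule ccontr)
  assume nin: "\<eta> *v u \<notin> range ((*v) X)"
  obtain Y t where Y: "\<And>k. Y k \<in> bounded_rank (rank X)" "\<And>k::nat. t k > (0::real)" "Y \<longlonglongrightarrow> X"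
    and lim: "(\<lambda>k. (Y k - X) /\<^sub>R t k) \<longlonglongrightarrow> \<eta>"
    by (rule tangent_coneE[OF \<eta>]) blast
  define E where "E = (\<lambda>k. (Y k - X) /\<^sub>R t k)"
  define S where "S = span (rows X) \<times> (UNIV :: real set)"
  define L where "L = (\<lambda>(M :: real^'n^'m) (N :: real^'n^'m) (p :: (real^'n) \<times> real). M *v fst p + snd p *\<^sub>R (N *v u))"
  have lin: "linear (L M N)" for M N :: "real^'n^'m"
    by (rule linearI)
      (simp_all add: L_def matrix_vector_right_distrib matrix_vector_mult_scaleR scaleR_add_left
        scaleR_add_right add_ac)
  have S: "subspace S"
    unfolding S_def by (intro subspace_Times subspace_span subspace_UNIV)
  have dimS: "dim S = rank X + 1"
    by (simp add: S_def dim_Times row_rank_def)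
  have "p = 0" if "p \<in> S" "L X \<eta> p = 0" for p
  proof -
    have eq: "X *v fst p = - (snd p *\<^sub>R (\<eta> *v u))"
      using that(2) by (simp add: L_def eq_neg_iff_add_eq_0)
    have "snd p = 0"
    proof (rule ccontr)
      assume nz: "snd p \<noteq> 0"
      have "X *v (- inverse (snd p) *\<^sub>R fst p) = \<eta> *v u"
        using nz by (simp add: matrix_vector_mult_scaleR eq del: scaleR_minus_left)
      then show False using nin by (metis rangeI)
    qed
    moreover have "fst p = 0"
      using matrix_vector_mul_injective_on_rowspace[of X "fst p" 0] eq \<open>snd p = 0\<close> that(1)
      by (simp add: S_def mem_Times_iff span_0)
    ultimately show ?thesis by (simp add: prod_eq_iff)
  qed
  then obtain e where e: "e > 0" "\<And>p. p \<in> S \<Longrightarrow> e * norm p \<le> norm (L X \<eta> p)"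
    using injective_imp_isometric[OF closed_subspace[OF S] S, of "L X \<eta>"] lin[of X \<eta>]
    by (auto simp: linear_conv_bounded_linear)
  define \<delta> where "\<delta> = (\<lambda>k. onorm ((*v) (Y k - X)) + norm ((E k - \<eta>) *v u))"
  have "(\<lambda>k. (\<Sum>a\<in>UNIV. \<Sum>b\<in>UNIV. \<bar>(Y k - X) $ a $ b\<bar>) + norm ((E k - \<eta>) *v u)) \<longlonglongrightarrow>
      (\<Sum>a\<in>UNIV. \<Sum>b\<in>UNIV. \<bar>(X - X) $ a $ b\<bar>) + norm ((\<eta> - \<eta>) *v u)"
    unfolding E_def
    by (intro tendsto_intros Y lim bounded_linear.tendsto[OF bounded_linear_matrix_vector_left])
  then have "\<forall>\<^sub>F k in sequentially. (\<Sum>a\<in>UNIV. \<Sum>b\<in>UNIV. \<bar>(Y k - X) $ a $ b\<bar>) + norm ((E k - \<eta>) *v u) < e"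
    by (intro order_tendstoD(2)) (use e in auto)
  then obtain k where
    "(\<Sum>a\<in>UNIV. \<Sum>b\<in>UNIV. \<bar>(Y k - X) $ a $ b\<bar>) + norm ((E k - \<eta>) *v u) < e"
    using eventually_happens'[OF sequentially_bot] by blast
  then have k: "\<delta> k < e"
    using onorm_le_matrix_component_sum[of "Y k - X"] by (simp add: \<delta>_def)
  have "p = 0" if p: "p \<in> S" "L (Y k) (E k) p = 0" for p
  proof (rule ccontr)
    assume "p \<noteq> 0"
    have proj: "norm (fst p) \<le> norm p" "norm (snd p) \<le> norm p"
      using norm_fst_le[of "fst p" "snd p"] norm_snd_le[of "snd p" "fst p"] by simp_all
    have "norm ((Y k - X) *v fst p) \<le> onorm ((*v) (Y k - X)) * norm (fst p)"
      by (rule onorm) simp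
    also have "\<dots> \<le> onorm ((*v) (Y k - X)) * norm p"
      by (intro mult_left_mono proj onorm_pos_le) simp
    finally have 1: "norm ((Y k - X) *v fst p) \<le> onorm ((*v) (Y k - X)) * norm p" .
    have 2: "norm (snd p *\<^sub>R ((E k - \<eta>) *v u)) \<le> norm ((E k - \<eta>) *v u) * norm p"
      using mult_right_mono[OF proj(2), of "norm ((E k - \<eta>) *v u)"] by (simp add: mult.commute)
    have "L X \<eta> p = - ((Y k - X) *v fst p + snd p *\<^sub>R ((E k - \<eta>) *v u))"
      using p(2) by (simp add: L_def algebra_simps)
    then have "norm (L X \<eta> p) = norm ((Y k - X) *v fst p + snd p *\<^sub>R ((E k - \<eta>) *v u))"
      by (simp only: norm_minus_cancel)
    then have "norm (L X \<eta> p) \<le> \<delta> k * norm p"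
      using 1 2 norm_triangle_ineq[of "(Y k - X) *v fst p" "snd p *\<^sub>R ((E k - \<eta>) *v u)"]
      by (simp add: \<delta>_def distrib_right)
    also have "\<dots> < e * norm p"
      using k \<open>p \<noteq> 0\<close> by simp
    finally show False using e(2)[OF p(1)] by simp
  qed
  moreover have "L (Y k) (E k) p = Y k *v (fst p + (snd p / t k) *\<^sub>R u)" for p
    using Y(2)[of k] Xu
    by (simp add: L_def E_def matrix_vector_right_distrib matrix_vector_mult_scaleR
        scaleR_matrix_vector_assoc[symmetric] matrix_vector_mult_diff_rdistrib divide_inverse)
  ultimately have "dim S \<le> dim (range ((*v) (Y k)))"
    using lin S by (intro linear_inj_dim_le[where f = "L (Y k) (E k)"]) auto
  then show False
    using Y(1)[of k] by (simp add: bounded_rank_def dimS rank_dim_range)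
qed

section \<open>Curves on the lifted manifold\<close>

lemma matrix_expansion: "M = (\<Sum>j\<in>UNIV. outer (M *v axis j 1) (axis j 1))"
  for M :: "real^'n^'m"
proof -
  have "outer (M *v axis j 1) (axis j 1) $ i $ k = (if k = j then M $ i $ j else 0)" for i j k
    by (simp add: outer_def matrix_vector_mult_basis column_def) (simp add: axis_def)
  then show ?thesis
    by (simp add: vec_eq_iff)
qed

lemma outer_scaleR: "outer (c *\<^sub>R a) b = c *\<^sub>R outer a b" "outer a (c *\<^sub>R b) = c *\<^sub>R outer a b"
  by (simp_all add: outer_def vec_eq_iff)

lemma has_vector_derivative_matrix_mult:
  fixes A :: "real \<Rightarrow> real^'k^'m" and B :: "real \<Rightarrow> real^'n^'k"
  assumes "(A has_vector_derivative A') (at t)" "(B has_vector_derivative B') (at t)"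
  shows "((\<lambda>t. A t ** B t) has_vector_derivative A t ** B' + A' ** B t) (at t)"
  using bounded_bilinear.FDERIV[OF bounded_bilinear_matrix_mult assms[unfolded has_vector_derivative_def]]
  by (simp add: has_vector_derivative_def matrix_mult_simps scaleR_add_right)

lemma plane_rotation_has_vector_derivative:
  "((\<lambda>t. plane_rotation w u (K * t)) has_vector_derivative
    K *\<^sub>R (cos (K * t) *\<^sub>R (outer w u - outer u w) - sin (K * t) *\<^sub>R (outer w w + outer u u))) (at t)"
  unfolding plane_rotation_def
  by (auto intro!: derivative_eq_intros simp: algebra_simps)

lemma plane_rotation_velocity_has_vector_derivative:
  "((\<lambda>t. K *\<^sub>R (cos (K * t) *\<^sub>R (outer w u - outer u w) - sin (K * t) *\<^sub>R (outer w w + outer u u)))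
    has_vector_derivative - K\<^sup>2 *\<^sub>R (outer w w + outer u u)) (at 0)"
  by (auto intro!: derivative_eq_intros simp: algebra_simps power2_eq_square)

lemma smooth_on_plane_rotation: "smooth_on (\<lambda>t. plane_rotation w u (K * t)) UNIV"
  by (simp add: smooth_on_def Ck_on_plane_rotation)

text \<open>All curves on the lift used below have this form: a curve \<open>x\<close> in the slice where \<open>G\<close> is kept fixed, moved
  by rotations acting on both components. Invariance of \<open>h\<close> keeps the curve in the zero set, and conjugating
  \<open>G\<close> along with \<open>x\<close> preserves \<open>X G = 0\<close>.\<close>

lemma rotated_curve:
  fixes h :: "real^'n^'m \<Rightarrow> real^'q" and x :: "real \<Rightarrow> real^'n^'m"
  assumes inv: "\<And>X Q. orthogonal_matrix Q \<Longrightarrow> h (X ** Q) = h X"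
    and mem: "(X, G) \<in> M_h r h"
    and x: "e > 0" "smooth_on x {-e<..<e}" "x 0 = X"
      "\<And>t. t \<in> {-e<..<e} \<Longrightarrow> h (x t) = 0 \<and> x t ** G = 0"
    and R: "smooth_on R UNIV" "\<And>t. orthogonal_matrix (R t)" "R 0 = mat 1"
  shows "smooth_curve_at (M_h r h) (X, G) (\<lambda>t. (x t ** R t, transpose (R t) ** G ** R t))"
  unfolding smooth_curve_at_def
proof (intro conjI exI[of _ e])
  let ?I = "{-e<..<e}"
  show "(x 0 ** R 0, transpose (R 0) ** G ** R 0) = (X, G)"
    by (simp add: x(3) R(3))
  have Ck_R: "Ck_on k R ?I" for k
    using R(1) Ck_on_subset unfolding smooth_on_def by blast
  have "Ck_on k (\<lambda>t. (x t ** R t, transpose (R t) ** G ** R t)) ?I" for k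
    using x(2) Ck_R
    by (intro Ck_on_Pair Ck_on_bilinear[OF _ bounded_bilinear_matrix_mult]
        Ck_on_compose_linear[OF _ bounded_linear_transpose] Ck_on_const)
      (auto simp: smooth_on_def)
  then show "smooth_on (\<lambda>t. (x t ** R t, transpose (R t) ** G ** R t)) ?I"
    by (simp add: smooth_on_def)
  have "(x t ** R t, transpose (R t) ** G ** R t) \<in> M_h r h" if "t \<in> ?I" for t
  proof -
    have "x t ** R t ** (transpose (R t) ** G ** R t) = x t ** (R t ** transpose (R t)) ** G ** R t"
      by (simp add: matrix_mul_assoc)
    also have "\<dots> = 0"
      using x(4)[OF that] R(2)[of t] by (simp add: orthogonal_matrix_def matrix_mult_simps)
    finally show ?thesis
      using mem x(4)[OF that] R(2)[of t]
      by (simp add: M_h_def orthogonal_conjugate_Gr inv)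
  qed
  then show "(\<lambda>t. (x t ** R t, transpose (R t) ** G ** R t)) ` ?I \<subseteq> M_h r h"
    by blast
qed (rule x(1))

section \<open>Derivatives of the objective along curves\<close>

text \<open>The point of the formula is that the acceleration enters linearly, while the remaining term depends on
  the velocity only; two curves with equal velocities can therefore be compared through their accelerations.\<close>

lemma curve_second_derivative:
  fixes f :: "'a::euclidean_space \<Rightarrow> real" and Y :: "real \<Rightarrow> 'a"
  assumes f: "Ck_on 2 f UNIV" and I: "open I" "0 \<in> I"
    and Y: "\<And>t. t \<in> I \<Longrightarrow> (Y has_vector_derivative Y' t) (at t)"
    and Y': "(Y' has_vector_derivative Y2) (at 0)"
  shows "deriv (deriv (\<lambda>t. f (Y t))) 0 = frechet_derivative f (at (Y 0)) Y2 +
    (\<Sum>b\<in>Basis. (Y' 0 \<bullet> b) * frechet_derivative (\<lambda>y. frechet_derivative f (at y) b) (at (Y 0)) (Y' 0))"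
proof -
  define D where "D = (\<lambda>y. frechet_derivative f (at y))"
  define H where "H = (\<lambda>b. frechet_derivative (\<lambda>y. D y b) (at (Y 0)))"
  have der_f: "(f has_derivative D y) (at y)" for y
    unfolding D_def using Ck_on_Suc_has_derivative[of 1 f UNIV] f by (simp add: numeral_2_eq_2)
  have lin: "linear (D y)" for y
    using der_f has_derivative_linear by blast
  have der_D: "((\<lambda>y. D y b) has_derivative H b) (at (Y 0))" for b
    unfolding H_def D_def
    using Ck_on_Suc_has_derivative[of 0 "\<lambda>y. frechet_derivative f (at y) b" UNIV] f
    by (simp add: numeral_2_eq_2)
  have expand: "D y v = (\<Sum>b\<in>Basis. (v \<bullet> b) * D y b)" for y v
  proof -
    have "D y (\<Sum>b\<in>Basis. (v \<bullet> b) *\<^sub>R b) = (\<Sum>b\<in>Basis. (v \<bullet> b) * D y b)"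
      by (simp add: linear_sum[OF lin] linear_scale[OF lin])
    then show ?thesis unfolding euclidean_representation .
  qed
  have first: "((\<lambda>t. f (Y t)) has_real_derivative D (Y t) (Y' t)) (at t)" if "t \<in> I" for t
    using has_derivative_compose[OF Y[OF that, unfolded has_vector_derivative_def] der_f]
    by (simp add: has_field_derivative_def linear_scale[OF lin] mult_commute_abs)
  have "deriv (\<lambda>t. f (Y t)) t = (\<Sum>b\<in>Basis. (Y' t \<bullet> b) * D (Y t) b)" if "t \<in> I" for t
    using DERIV_imp_deriv[OF first[OF that]] expand[of "Y t" "Y' t"] by simp
  then have "\<forall>\<^sub>F t in nhds 0. deriv (\<lambda>t. f (Y t)) t = (\<Sum>b\<in>Basis. (Y' t \<bullet> b) * D (Y t) b)"
    using eventually_nhds_in_open[OF I] by (auto elim: eventually_mono)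
  then have "deriv (deriv (\<lambda>t. f (Y t))) 0 = deriv (\<lambda>t. \<Sum>b\<in>Basis. (Y' t \<bullet> b) * D (Y t) b) 0"
    by (rule deriv_cong_ev) simp
  also have "\<dots> = (\<Sum>b\<in>Basis. (Y' 0 \<bullet> b) * H b (Y' 0) + (Y2 \<bullet> b) * D (Y 0) b)"
  proof (rule DERIV_imp_deriv, rule DERIV_sum)
    fix b :: 'a
    have "((\<lambda>t. D (Y t) b) has_real_derivative H b (Y' 0)) (at 0)"
      using has_derivative_compose[OF Y[OF I(2), unfolded has_vector_derivative_def] der_D]
      by (simp add: has_field_derivative_def linear_scale[OF has_derivative_linear[OF der_D]] mult_commute_abs)
    moreover have "((\<lambda>t. Y' t \<bullet> b) has_real_derivative Y2 \<bullet> b) (at 0)"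
      using bounded_linear.has_vector_derivative[OF bounded_linear_inner_left Y']
      by (simp add: has_real_derivative_iff_has_vector_derivative)
    ultimately show "((\<lambda>t. (Y' t \<bullet> b) * D (Y t) b) has_real_derivative
        (Y' 0 \<bullet> b) * H b (Y' 0) + (Y2 \<bullet> b) * D (Y 0) b) (at 0)"
      by (auto intro!: derivative_eq_intros)
  qed
  also have "\<dots> = D (Y 0) Y2 + (\<Sum>b\<in>Basis. (Y' 0 \<bullet> b) * H b (Y' 0))"
    by (simp add: sum.distrib expand[of "Y 0" Y2])
  finally show ?thesis
    unfolding D_def H_def .
qed

lemma stationary_curve_first_order:
  fixes f :: "real^'n^'m \<Rightarrow> real"
  assumes der: "(f has_derivative D) (at X)"
    and stat: "second_order_stationary M (f \<circ> \<phi>) (X, G)"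
    and \<gamma>: "smooth_curve_at M (X, G) \<gamma>"
    and v: "((\<lambda>t. fst (\<gamma> t)) has_vector_derivative v) (at 0)"
  shows "D v = 0"
proof -
  obtain e where e: "e > 0" "smooth_on \<gamma> {-e<..<e}"
    using \<gamma> unfolding smooth_curve_at_def by blast
  have "\<gamma> differentiable at 0"
    using e unfolding smooth_on_def by (metis Ck_on.simps(2) greaterThanLessThan_iff neg_less_0_iff_less)
  then have der_\<gamma>: "(\<gamma> has_vector_derivative vector_derivative \<gamma> (at 0)) (at 0)"
    by (simp add: vector_derivative_works)
  have "((\<lambda>t. fst (\<gamma> t)) has_vector_derivative fst (vector_derivative \<gamma> (at 0))) (at 0)"
    using bounded_linear.has_vector_derivative[OF bounded_linear_fst der_\<gamma>] .
  then have "v = fst (vector_derivative \<gamma> (at 0))"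
    using v vector_derivative_at by metis
  moreover have "((f \<circ> \<phi>) has_derivative (\<lambda>p. D (fst p))) (at (X, G))"
    using has_derivative_compose[OF has_derivative_fst[OF has_derivative_ident], of f D "(X, G)"] der
    by (simp add: o_def \<phi>_def case_prod_unfold)
  moreover have "vector_derivative \<gamma> (at 0) \<in> tangent_space M (X, G)"
    using \<gamma> unfolding tangent_space_def by blast
  ultimately show ?thesis
    using stat frechet_derivative_at unfolding second_order_stationary_def by metis
qed

lemma stationary_curve_second_order:
  fixes f :: "real^'n^'m \<Rightarrow> real"
  assumes stat: "second_order_stationary M (f \<circ> \<phi>) (X, G)"
    and \<gamma>: "smooth_curve_at M (X, G) (\<lambda>t. (Y t, Z t))"
  shows "deriv (deriv (\<lambda>t. f (Y t))) 0 \<ge> 0"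
  using stat \<gamma> unfolding second_order_stationary_def by (auto simp: o_def \<phi>_def)

section \<open>Second-order stationary points of the lift\<close>

locale second_order_stationary_lift =
  fixes r :: nat and h :: "real^'n^'m \<Rightarrow> real^'q" and f :: "real^'n^'m \<Rightarrow> real"
    and X :: "real^'n^'m" and G :: "real^'n^'n"
  assumes r_le: "r \<le> CARD('n)"
    and smooth_h: "smooth_on h UNIV"
    and invariant: "\<And>X Q. orthogonal_matrix Q \<Longrightarrow> h (X ** Q) = h X"
    and regular: "\<And>X. X \<in> zero_set h \<Longrightarrow> dim (range (frechet_derivative h (at X))) = CARD('q)"
    and C2_f: "Ck_on 2 f UNIV"
    and stationary: "second_order_stationary (M_h r h) (f \<circ> \<phi>) (X, G)"
begin

abbreviation "Dh \<equiv> frechet_derivative h (at X)"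
abbreviation "Df \<equiv> frechet_derivative f (at X)"

lemma mem: "(X, G) \<in> M_h r h"
  using stationary by (simp add: second_order_stationary_def)

lemma G: "orth_projector G" and rank_G: "rank G = CARD('n) - r" and XG: "X ** G = 0" and hX: "h X = 0"
  using mem by (simp_all add: M_h_def Gr_iff)

lemma transpose_G: "transpose G = G" and GG: "G ** G = G"
  using G by (simp_all add: orth_projector_def)

lemma rank_X: "rank X \<le> r"
  using rank_add_orth_projector_le[OF G XG] r_le by (simp add: rank_G)

lemma der_h: "(h has_derivative Dh) (at X)"
  using Ck_on_Suc_has_derivative[of 0 h UNIV X] smooth_h unfolding smooth_on_def by blast

lemma der_f: "(f has_derivative Df) (at X)"
  using Ck_on_Suc_has_derivative[of 1 f UNIV X] C2_f by (simp add: numeral_2_eq_2)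

lemma linear_Dh: "linear Dh" and linear_Df: "linear Df"
  using der_h der_f has_derivative_linear by blast+

text \<open>The reflection \<open>1 - 2 P\<close> is orthogonal and fixes \<open>X\<close>. Differentiating the invariance of \<open>h\<close> under it
  at \<open>X\<close> gives \<open>Dh (\<eta> (1 - 2 P)) = Dh \<eta>\<close>.\<close>

lemma Dh_mult_projector:
  assumes P: "orth_projector P" and XP: "X ** P = 0"
  shows "Dh (\<eta> ** P) = 0"
proof -
  define Q where "Q = mat 1 - 2 *\<^sub>R P"
  have "transpose Q = Q"
    using P by (simp add: Q_def orth_projector_def transpose_def mat_def vec_eq_iff)
  moreover have "Q ** Q = mat 1"
    using P by (simp add: Q_def matrix_mult_simps orth_projector_def vec_eq_iff algebra_simps)
  ultimately have Q: "orthogonal_matrix Q"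
    by (simp add: orthogonal_matrix)
  have XQ: "X ** Q = X"
    by (simp add: Q_def matrix_mult_simps XP)
  have "((\<lambda>Z. Z ** Q) has_derivative (\<lambda>Z. Z ** Q)) (at X)"
    by (intro bounded_linear_imp_has_derivative
        bounded_bilinear.bounded_linear_left[OF bounded_bilinear_matrix_mult])
  from has_derivative_compose[OF this, of h Dh]
  have "(h has_derivative (\<lambda>Z. Dh (Z ** Q))) (at X)"
    using der_h by (simp add: XQ invariant[OF Q])
  then have "Dh = (\<lambda>Z. Dh (Z ** Q))"
    using der_h has_derivative_unique by blast
  then have "Dh \<eta> = Dh (\<eta> ** Q)"
    by metis
  then show ?thesis
    by (simp add: Q_def matrix_mult_simps linear_diff[OF linear_Dh] linear_scale[OF linear_Dh])
qed

text \<open>The part \<open>\<eta> G\<close> of a direction is invisible to \<open>Dh\<close> and can be subtracted.\<close>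

lemma Dh_onto: "Dh ` {Z. Z ** G = 0} = UNIV"
proof (rule equalityI[OF subset_UNIV], rule subsetI)
  fix y
  have "dim (range Dh) = DIM(real^'q)"
    using regular[of X] hX by (simp add: zero_set_def)
  then have "span (range Dh) = UNIV"
    by (simp only: dim_eq_full)
  then have "range Dh = UNIV"
    using linear_subspace_image[OF linear_Dh subspace_UNIV] by (metis span_eq_iff)
  then obtain \<eta> where \<eta>: "y = Dh \<eta>"
    by (metis UNIV_I imageE)
  have "Dh (\<eta> - \<eta> ** G) = y"
    by (simp add: linear_diff[OF linear_Dh] Dh_mult_projector[OF G XG] \<eta>)
  moreover have "(\<eta> - \<eta> ** G) ** G = 0"
    by (simp add: matrix_mult_simps GG flip: matrix_mul_assoc)
  ultimately show "y \<in> Dh ` {Z. Z ** G = 0}"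
    by blast
qed

lemma level_curve:
  assumes "\<eta> ** G = 0" "Dh \<eta> = 0"
  obtains e x where "e > 0" "smooth_on x {-e<..<e}" "x 0 = X"
    "(x has_vector_derivative \<eta>) (at 0)"
    "\<And>t. t \<in> {-e<..<e} \<Longrightarrow> h (x t) = 0 \<and> x t ** G = 0"
proof -
  have "subspace {Z :: real^'n^'m. Z ** G = 0}"
    by (simp add: subspace_def matrix_mult_simps)
  then obtain e x where x: "e > 0" "smooth_on x {-e<..<e}" "x 0 = X"
    "(x has_vector_derivative \<eta>) (at 0)"
    "\<And>t. t \<in> {-e<..<e} \<Longrightarrow> h (x t) = 0 \<and> x t - X \<in> {Z. Z ** G = 0}"
    using smooth_curve_in_level_set[OF smooth_h hX _ Dh_onto, of \<eta>] assms by blast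
  then have "h (x t) = 0 \<and> x t ** G = 0" if "t \<in> {-e<..<e}" for t
    using x(5)[OF that] by (simp add: matrix_mult_simps XG)
  with x that show thesis by blast
qed

text \<open>First-order stationarity along curves that keep \<open>G\<close> fixed.\<close>

lemma Df_level_direction:
  assumes "\<eta> ** G = 0" "Dh \<eta> = 0"
  shows "Df \<eta> = 0"
proof -
  obtain e x where x: "e > 0" "smooth_on x {-e<..<e}" "x 0 = X"
    "(x has_vector_derivative \<eta>) (at 0)"
    "\<And>t. t \<in> {-e<..<e} \<Longrightarrow> h (x t) = 0 \<and> x t ** G = 0"
    using level_curve[OF assms] by blast
  have "smooth_on (\<lambda>t :: real. mat 1 :: real^'n^'n) UNIV"
    by (simp add: smooth_on_def Ck_on_const)
  from rotated_curve[OF invariant mem x(1,2,3,5) this]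
  have "smooth_curve_at (M_h r h) (X, G) (\<lambda>t. (x t, G))"
    by (simp add: orthogonal_matrix_id transpose_mat)
  from stationary_curve_first_order[OF der_f stationary this] show ?thesis
    using x(4) by simp
qed

text \<open>First-order stationarity along the curves that keep \<open>X\<close> fixed up to a rotation: the rotation
  in the plane of \<open>w\<close> and \<open>u\<close> moves \<open>X\<close> with velocity \<open>outer (X w) u\<close>, because \<open>X u = 0\<close>. Only the component
  of \<open>w\<close> orthogonal to the range of \<open>G\<close> matters, since \<open>X G = 0\<close>.\<close>

lemma Df_rotation_direction:
  assumes Gu: "G *v u = u"
  shows "Df (outer (X *v w) u) = 0"
proof -
  define w' where "w' = w - G *v w"
  have Xw': "X *v w' = X *v w"
    by (simp add: w'_def matrix_vector_mult_diff_distrib matrix_vector_mul_assoc XG)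
  have Xu: "X *v u = 0"
    using XG Gu by (metis matrix_vector_mul_assoc matrix_vector_mult_0)
  have w'u: "w' \<bullet> u = 0"
  proof -
    have "(G *v w) \<bullet> u = w \<bullet> u"
      using inner_matrix_vector_transpose[of G w u] Gu by (simp add: transpose_G del: transpose_matrix_vector)
    then show ?thesis by (simp add: w'_def inner_diff_left)
  qed
  show ?thesis
  proof (cases "w' = 0 \<or> u = 0")
    case True
    then have "outer (X *v w) u = 0"
      using Xw' by auto
    then show ?thesis by (simp add: linear_0[OF linear_Df])
  next
    case False
    define a b where "a = w' /\<^sub>R norm w'" and "b = u /\<^sub>R norm u"
    have ab: "norm a = 1" "norm b = 1" "a \<bullet> b = 0"
      using False w'u by (simp_all add: a_def b_def)
    have "X *v b = 0"
      by (simp add: b_def matrix_vector_mult_scaleR Xu)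
    then have vel: "X ** (outer a b - outer b a) = outer (X *v a) b"
      by (simp add: matrix_mult_simps matrix_mult_outer)
    have "smooth_on (\<lambda>t::real. X) {-1<..<1}"
      by (simp add: smooth_on_def Ck_on_const)
    from rotated_curve[OF invariant mem _ this _ _ smooth_on_plane_rotation[of a b 1]]
    have "smooth_curve_at (M_h r h) (X, G) (\<lambda>t. (X ** plane_rotation a b (1 * t),
        transpose (plane_rotation a b (1 * t)) ** G ** plane_rotation a b (1 * t)))"
      using orthogonal_plane_rotation[OF ab] XG hX by simp
    moreover have "((\<lambda>t. X ** plane_rotation a b (1 * t)) has_vector_derivative outer (X *v a) b) (at 0)"
      using has_vector_derivative_matrix_mult[OF has_vector_derivative_const[of X]
          plane_rotation_has_vector_derivative[of a b 1 0]]
      by (simp add: vel matrix_mult_simps(9))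
    ultimately have "Df (outer (X *v a) b) = 0"
      using stationary_curve_first_order[OF der_f stationary] by simp
    moreover have "outer (X *v w) u = norm w' *\<^sub>R norm u *\<^sub>R outer (X *v a) b"
    proof -
      have "X *v w = norm w' *\<^sub>R (X *v a)" "u = norm u *\<^sub>R b"
        using False by (simp_all add: a_def b_def matrix_vector_mult_scaleR Xw')
      then show ?thesis
        by (metis outer_scaleR)
    qed
    ultimately show ?thesis
      by (simp add: linear_scale[OF linear_Df])
  qed
qed

text \<open>Here the second-order condition enters. After normalization let \<open>a\<close> and \<open>b\<close> be
  the unit vectors along \<open>w\<close> and \<open>u\<close>; both lie in the kernel of \<open>X\<close>. A curve \<open>x\<close> in the slice with velocity
  \<open>\<eta> = outer v a\<close>, rotated in the plane of \<open>a\<close> and \<open>b\<close> with angular speed \<open>K\<close>, still has velocity \<open>\<eta>\<close>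
  at \<open>0\<close>, because the rotations do not move \<open>X\<close>. Its acceleration is that of \<open>x\<close> plus
  \<open>2 K outer v b\<close>. The second derivative of \<open>f\<close> along the curve is thus an affine function of \<open>K\<close>
  with slope \<open>2 Df (outer v b)\<close>, and it is nonnegative for every real \<open>K\<close>; so the slope vanishes.\<close>

lemma Df_kernel_direction:
  assumes w: "w \<noteq> 0" "X *v w = 0" "G *v w = 0" and Gu: "G *v u = u"
  shows "Df (outer v u) = 0"
proof (cases "u = 0")
  case True
  then show ?thesis by (simp add: linear_0[OF linear_Df])
next
  case False
  define a b where "a = w /\<^sub>R norm w" and "b = u /\<^sub>R norm u"
  have wu: "w \<bullet> u = 0"
    using inner_matrix_vector_transpose[of G w u] Gu w(3) by (simp add: transpose_G del: transpose_matrix_vector)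
  have ab: "norm a = 1" "norm b = 1" "a \<bullet> b = 0"
    using False w(1) wu by (simp_all add: a_def b_def)
  have kernel: "X *v a = 0" "G *v a = 0" "X *v b = 0"
    using w(2,3) XG Gu
    by (simp_all add: a_def b_def matrix_vector_mult_scaleR) (metis matrix_vector_mul_assoc matrix_vector_mult_0)
  have aa: "a \<bullet> a = 1" "b \<bullet> b = 1"
    using ab by (simp_all add: dot_square_norm)
  define \<eta> where "\<eta> = outer v a"
  have \<eta>G: "\<eta> ** G = 0"
    by (simp add: \<eta>_def outer_mult_matrix transpose_G kernel del: transpose_matrix_vector)
  have "orth_projector (outer a a)"
    by (simp add: orth_projector_def outer_mult_outer aa)
  moreover have "X ** outer a a = 0"
    by (simp add: matrix_mult_outer kernel)
  ultimately have "Dh (\<eta> ** outer a a) = 0"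
    by (rule Dh_mult_projector)
  then have Dh\<eta>: "Dh \<eta> = 0"
    by (simp add: \<eta>_def outer_mult_outer aa)
  obtain e x where x: "e > 0" "smooth_on x {-e<..<e}" "x 0 = X"
    and der_x: "(x has_vector_derivative \<eta>) (at 0)"
    and level: "\<And>t. t \<in> {-e<..<e} \<Longrightarrow> h (x t) = 0 \<and> x t ** G = 0"
    using level_curve[OF \<eta>G Dh\<eta>] by blast
  let ?I = "{-e<..<e}"
  define x' where "x' = (\<lambda>t. frechet_derivative x (at t) 1)"
  have "Ck_on 2 x ?I"
    using x(2) by (simp add: smooth_on_def)
  then have C2_x: "Ck_on (Suc 1) x ?I"
    by (simp add: numeral_2_eq_2)
  have der_x': "(x has_vector_derivative x' t) (at t)" if "t \<in> ?I" for t
    unfolding x'_def using Ck_on_curveD(1)[OF C2_x that] .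
  have "Ck_on (Suc 0) x' ?I"
    unfolding x'_def using Ck_on_curveD(2)[OF C2_x] by simp
  then obtain x2 where x2: "(x' has_vector_derivative x2) (at 0)"
    using Ck_on_curveD(1)[of 0 x' ?I 0] x(1) by auto
  have x'0: "x' 0 = \<eta>"
    using der_x der_x'[of 0] x(1) vector_derivative_at by (metis greaterThanLessThan_iff neg_less_0_iff_less)
  have ineq: "0 \<le> Df x2 + (\<Sum>b\<in>Basis. (\<eta> \<bullet> b) * frechet_derivative (\<lambda>y. frechet_derivative f (at y) b) (at X) \<eta>)
      + K * (2 * Df (outer v b))" for K
  proof -
    define R where "R = (\<lambda>t. plane_rotation a b (K * t))"
    define R' where "R' = (\<lambda>t. K *\<^sub>R (cos (K * t) *\<^sub>R (outer a b - outer b a) - sin (K * t) *\<^sub>R (outer a a + outer b b)))"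
    define R2 where "R2 = - K\<^sup>2 *\<^sub>R (outer a a + outer b b)"
    have R: "(R has_vector_derivative R' t) (at t)" "(R' has_vector_derivative R2) (at 0)" "R 0 = mat 1" for t
      unfolding R_def R'_def R2_def
      using plane_rotation_has_vector_derivative plane_rotation_velocity_has_vector_derivative by auto
    have R'0: "R' 0 = K *\<^sub>R (outer a b - outer b a)"
      by (simp add: R'_def)
    have "smooth_curve_at (M_h r h) (X, G) (\<lambda>t. (x t ** R t, transpose (R t) ** G ** R t))"
      unfolding R_def
      by (intro rotated_curve[OF invariant mem x level] smooth_on_plane_rotation
          orthogonal_plane_rotation ab) simp_all
    then have "0 \<le> deriv (deriv (\<lambda>t. f (x t ** R t))) 0"
      by (rule stationary_curve_second_order[OF stationary])
    also have "\<dots> = Df (X ** R2 + \<eta> ** R' 0 + (\<eta> ** R' 0 + x2)) +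
        (\<Sum>b\<in>Basis. (\<eta> \<bullet> b) * frechet_derivative (\<lambda>y. frechet_derivative f (at y) b) (at X) \<eta>)"
    proof -
      have Y: "((\<lambda>t. x t ** R t) has_vector_derivative x t ** R' t + x' t ** R t) (at t)" if "t \<in> ?I" for t
        using has_vector_derivative_matrix_mult[OF der_x'[OF that] R(1)] .
      have "((\<lambda>t. x t ** R' t + x' t ** R t) has_vector_derivative
          (x 0 ** R2 + x' 0 ** R' 0) + (x' 0 ** R' 0 + x2 ** R 0)) (at 0)"
        using x(1) by (intro has_vector_derivative_add has_vector_derivative_matrix_mult der_x' R x2) auto
      from curve_second_derivative[OF C2_f, of ?I, OF _ _ Y this]
      show ?thesis
        using x(1) by (simp add: x(3) x'0 R(3) R'0 matrix_mult_simps matrix_mult_outer kernel)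
    qed
    also have "X ** R2 = 0"
      by (simp add: R2_def matrix_mult_simps matrix_mult_outer kernel)
    also have "\<eta> ** R' 0 = K *\<^sub>R outer v b"
      using ab(3) by (simp add: R'0 \<eta>_def matrix_mult_simps outer_mult_outer aa inner_commute)
    finally show ?thesis
      unfolding linear_add[OF linear_Df] linear_scale[OF linear_Df] linear_0[OF linear_Df]
        real_scaleR_def
      by (simp add: algebra_simps)
  qed
  have affine_nonneg: "q = 0" if "\<And>K. 0 \<le> p + K * q" for p q :: real
  proof (rule ccontr)
    assume "q \<noteq> 0"
    then have "p + (- (p + 1) / q) * q = -1" by simp
    then show False using that[of "- (p + 1) / q"] by simp
  qed
  have "2 * Df (outer v b) = 0"
    using ineq by (rule affine_nonneg)
  moreover have "outer v u = norm u *\<^sub>R outer v b"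
    using False by (simp add: b_def outer_scaleR)
  ultimately show ?thesis
    by (simp add: linear_scale[OF linear_Df])
qed

text \<open>The gradient is a definite description, so uniqueness of the representing vector has to be shown as well.\<close>

lemma gradient_inner: "gradient f X \<bullet> \<eta> = Df \<eta>"
proof -
  define g where "g = (\<Sum>b\<in>Basis. Df b *\<^sub>R b)"
  have g: "g \<bullet> \<eta> = Df \<eta>" for \<eta>
  proof -
    have "Df \<eta> = Df (\<Sum>b\<in>Basis. (\<eta> \<bullet> b) *\<^sub>R b)"
      by (simp only: euclidean_representation)
    also have "\<dots> = g \<bullet> \<eta>"
      by (simp only: linear_sum[OF linear_Df] linear_scale[OF linear_Df] g_def inner_sum_left)
        (simp add: inner_commute mult.commute)
    finally show ?thesis by simp
  qed
  have "GDERIV f X :> g"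
    unfolding gderiv_def using der_f g by (simp add: inner_commute)
  moreover have "g' = g" if "GDERIV f X :> g'" for g'
  proof -
    have "(\<lambda>v. v \<bullet> g') = (\<lambda>v. v \<bullet> g)"
      using that \<open>GDERIV f X :> g\<close> unfolding gderiv_def by (rule has_derivative_unique)
    then show ?thesis
      by (metis inner_commute vector_eq_rdot)
  qed
  ultimately have "gradient f X = g"
    unfolding gradient_def by (rule the_equality)
  then show ?thesis using g by simp
qed

text \<open>A tangent direction \<open>\<eta>\<close> splits into \<open>\<eta> (1 - G)\<close>, a slice direction, and \<open>\<eta> G\<close>, a sum of
  matrices \<open>outer (\<eta> G c) (G c)\<close>. If the rank of \<open>X\<close> drops below \<open>r\<close>, the kernel of \<open>X\<close> contains a vector orthogonal to the
  range of \<open>G\<close> and the second-order condition disposes of all the summands. If the rank is \<open>r\<close>, tangency to the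
  matrices of bounded rank puts \<open>\<eta> G c\<close> in the range of \<open>X\<close>, and the summands are rotation directions.\<close>

lemma first_order_stationary_X: "first_order_stationary (bounded_rank r \<inter> zero_set h) f X"
  unfolding first_order_stationary_def
proof (intro conjI ballI)
  show "X \<in> bounded_rank r \<inter> zero_set h"
    using rank_X hX by (simp add: bounded_rank_def zero_set_def)
  fix \<eta> assume \<eta>: "\<eta> \<in> tangent_cone (bounded_rank r \<inter> zero_set h) X"
  have "\<eta> \<in> tangent_cone {Z. h Z = 0} X"
    using \<eta> tangent_cone_mono[of "bounded_rank r \<inter> zero_set h" "{Z. h Z = 0}" X]
    by (auto simp: zero_set_def)
  then have "Dh \<eta> = 0"
    by (rule derivative_vanishes_on_tangent_cone[OF der_h hX])
  then have "Dh (\<eta> - \<eta> ** G) = 0"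
    by (simp add: linear_diff[OF linear_Dh] Dh_mult_projector[OF G XG])
  moreover have "(\<eta> - \<eta> ** G) ** G = 0"
    by (simp add: matrix_mult_simps GG flip: matrix_mul_assoc)
  ultimately have "Df (\<eta> - \<eta> ** G) = 0"
    by (intro Df_level_direction)
  moreover have "Df (\<eta> ** G) = 0"
  proof -
    have outer_zero: "Df (outer (\<eta> *v (G *v c)) (G *v c')) = 0" for c c'
    proof -
      have GG_apply: "G *v (G *v c') = G *v c'"
        by (simp add: matrix_vector_mul_assoc GG)
      show ?thesis
      proof (cases "rank X < r")
        case True
        then have "rank X + rank G < CARD('n)"
          using r_le by (simp add: rank_G)
        then obtain w where "w \<noteq> 0" "X *v w = 0" "G *v w = 0"
          by (rule common_kernel_vector)
        then show ?thesis
          by (rule Df_kernel_direction) (rule GG_apply)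
      next
        case False
        then have "rank X = r"
          using rank_X by simp
        then have "\<eta> \<in> tangent_cone (bounded_rank (rank X)) X"
          using \<eta> tangent_cone_mono[of "bounded_rank r \<inter> zero_set h" "bounded_rank r" X] by blast
        moreover have "X *v (G *v c) = 0"
          by (simp add: matrix_vector_mul_assoc XG)
        ultimately obtain w where "\<eta> *v (G *v c) = X *v w"
          using tangent_cone_bounded_rank by blast
        then show ?thesis
          using Df_rotation_direction[OF GG_apply] by simp
      qed
    qed
    have "\<eta> ** G = (\<Sum>j\<in>UNIV. outer ((\<eta> ** G) *v axis j 1) (axis j 1)) ** G"
      by (simp add: GG flip: matrix_expansion matrix_mul_assoc)
    also have "\<dots> = (\<Sum>j\<in>UNIV. outer (\<eta> *v (G *v axis j 1)) (G *v axis j 1))"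
      by (simp add: bounded_bilinear.sum_left[OF bounded_bilinear_matrix_mult] outer_mult_matrix
          transpose_G matrix_vector_mul_assoc del: transpose_matrix_vector)
    finally show ?thesis
      by (simp add: linear_sum[OF linear_Df] outer_zero)
  qed
  ultimately have "Df \<eta> = 0"
    by (simp add: linear_diff[OF linear_Df])
  then show "0 \<le> gradient f X \<bullet> \<eta>"
    by (simp add: gradient_inner)
qed

end

section \<open>Accumulation points and the theorem\<close>

lemma closed_M_h:
  fixes h :: "real^'n^'m \<Rightarrow> real^'q"
  assumes "continuous_on UNIV h"
  shows "closed (M_h r h)"
proof -
  have "M_h r h = (UNIV \<times> Gr (CARD('n) - r)) \<inter> {p. fst p ** snd p = 0} \<inter> {p. h (fst p) = 0}"
    by (auto simp: M_h_def)
  moreover have "closed {p :: (real^'n^'m) \<times> (real^'n^'n). fst p ** snd p = 0}"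
    by (intro closed_Collect_eq bounded_bilinear.continuous_on[OF bounded_bilinear_matrix_mult]
        continuous_intros)
  moreover have "closed {p :: (real^'n^'m) \<times> (real^'n^'n). h (fst p) = 0}"
    by (intro closed_Collect_eq continuous_on_compose2[OF assms] continuous_intros) auto
  ultimately show ?thesis
    by (simp add: closed_Int closed_Times compact_imp_closed[OF compact_Gr])
qed

theorem theorem4:
  fixes r :: nat
    and h :: "real^'n^'m \<Rightarrow> real^'q"
    and f :: "real^'n^'m \<Rightarrow> real"
    and X\<^sub>0 :: "real^'n^'m"
    and G\<^sub>0 :: "real^'n^'n"
    and Z :: "nat \<Rightarrow> (real^'n^'m) \<times> (real^'n^'n)"
  assumes "r \<le> min CARD('m) CARD('n)"
    and "smooth_on h UNIV"
    and "\<And>X Q. orthogonal_matrix Q \<Longrightarrow> h (X ** Q) = h X"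
    and "\<And>X. X \<in> zero_set h \<Longrightarrow> dim (range (frechet_derivative h (at X))) = CARD('q)"
    and "Ck_on 2 f UNIV"
    and "(X\<^sub>0, G\<^sub>0) \<in> M_h r h"
    and "compact {X. f X \<le> f X\<^sub>0}"
    and "\<And>k. Z k \<in> M_h r h"
    and "Z 0 = (X\<^sub>0, G\<^sub>0)"
    and "\<And>k. (f \<circ> \<phi>) (Z (Suc k)) \<le> (f \<circ> \<phi>) (Z k)"
  shows "(\<exists>p. accumulation_point_in (M_h r h) Z p) \<and>
    (\<forall>X G. accumulation_point_in (M_h r h) Z (X, G) \<longrightarrow>
       second_order_stationary (M_h r h) (f \<circ> \<phi>) (X, G) \<longrightarrow>
       first_order_stationary (bounded_rank r \<inter> zero_set h) f X)"
proof (intro conjI allI impI)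
  let ?K = "{X. f X \<le> f X\<^sub>0} \<times> (Gr (CARD('n) - r) :: (real^'n^'n) set)"
  have "f (fst (Z k)) \<le> f X\<^sub>0" for k
  proof (induction k)
    case 0
    then show ?case using assms(9) by simp
  next
    case (Suc k)
    then show ?case using assms(10)[of k] by (simp add: \<phi>_def case_prod_unfold)
  qed
  then have "Z k \<in> ?K" for k
    using assms(8)[of k] by (auto simp: M_h_def mem_Times_iff case_prod_unfold)
  then obtain p \<sigma> where "strict_mono \<sigma>" "(Z \<circ> \<sigma>) \<longlonglongrightarrow> p"
    using compact_Times[OF assms(7) compact_Gr] unfolding compact_def by metis
  moreover have "continuous_on UNIV h"
    using assms(2) unfolding smooth_on_def by (metis Ck_on.simps(1))
  then have "p \<in> M_h r h"
    using closed_sequentially[OF closed_M_h] assms(8) \<open>(Z \<circ> \<sigma>) \<longlonglongrightarrow> p\<close> by (metis comp_apply)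
  ultimately show "\<exists>p. accumulation_point_in (M_h r h) Z p"
    unfolding accumulation_point_in_def by blast
next
  fix X G
  assume "second_order_stationary (M_h r h) (f \<circ> \<phi>) (X, G)"
  then interpret second_order_stationary_lift r h f X G
    using assms(1-5) by unfold_locales auto
  show "first_order_stationary (bounded_rank r \<inter> zero_set h) f X"
    by (rule first_order_stationary_X)
qed

end
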